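(* Let $\mathcal{M}=\{(h,t)\in[1,\infty)\times[0,\pi] : t\le \arccos(-\frac{3h^2+1}{4h^2})\}$ and, for $(h,t)\in\mathcal{M}$, let $\rho_{(h,t)}:G\to\mathbf{PU}(3,1)$ be the representation defined in the context, of the group $$G=\langle \iota_1,\iota_2,\iota_3,\iota_4 \mid \iota_1^2=\iota_2^2=\iota_3^2=\iota_4^2=(\iota_1\iota_3)^2=(\iota_1\iota_4)^3=(\iota_2\iota_4)^2=id\rangle .$$ There is a neighborhood $U$ of $(\sqrt{2},\arccos(-\frac{7}{8}))$ in $\mathcal{M}$ such that $\rho_{(h,t)}$ is a discrete and faithful representation of $G$ into $\mathbf{PU}(3,1)$ whenever $(h,t)\in U$.
   Context: Let $\mathbb{C}^{3,1}$ be $\mathbb{C}^4$ with the Hermitian form $\langle\mathbf z,\mathbf w\rangle=\mathbf w^*H\mathbf z$, where $H=\begin{pmatrix}0&0&0&1\\0&1&0&0\\0&0&1&0\\1&0&0&0\end{pmatrix}$, of signature $(3,1)$. $\mathbf{PU}(3,1)$ is the group of complex linear maps preserving this form, modulo scalars; it is the holomorphic isometry group of complex hyperbolic space $\mathbf{H}^3_{\mathbb C}$ (the set of negative lines in $\mathbb{C}\mathbf{P}^3$). For $(h,t)\in\mathcal{M}$ set $D=\sqrt{4h^2\cos t+3h^2+1}$ (real and nonnegative on $\mathcal{M}$) and $$n_1=\begin{pmatrix}0\\1\\0\\0\end{pmatrix},\quad n_2=\begin{pmatrix}1\\-1\\0\\0\end{pmatrix},\quad n_3=\begin{pmatrix}-\frac{1}{2h}\\0\\0\\-h\end{pmatrix},\quad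 n_4=\begin{pmatrix}\frac{4h^2+e^{-t\mathrm i}}{4h^2}\\[2pt]-\frac{e^{-t\mathrm i}}{2}\\[2pt]\frac{D}{2h}\\[2pt]-\frac{e^{-t\mathrm i}}{2}\end{pmatrix}.$$ These satisfy $\langle n_i,n_i\rangle=1$. Let $I_i(\mathbf z)=-\mathbf z+2\langle\mathbf z,n_i\rangle n_i$ for $i=1,2,3,4$; its class in $\mathbf{PU}(3,1)$ is the order-two complex reflection whose mirror is the complex hyperbolic plane with polar vector $n_i$. The $I_i$ satisfy the relations of $G$ (and $I_1I_2$ is parabolic), and $\rho_{(h,t)}$ is the homomorphism with $\rho_{(h,t)}(\iota_i)=I_i$. When $t=\arccos(-\frac{3h^2+1}{4h^2})$, one has $D=0$ and the image preserves a totally geodesic copy of $\mathbf{H}^2_{\mathbb C}$. A representation is discrete if its image is a discrete subgroup, and faithful if it is injective. *)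

theory Defs
  imports "HOL-Analysis.Analysis" "HOL-Algebra.Coset"
begin

section \<open>Groups given by a presentation\<close>

text \<open>A letter \<open>(s, True)\<close> stands for the generator \<open>s\<close> and \<open>(s, False)\<close> for its formal inverse.
  The group \<open>\<langle>S | R\<rangle>\<close>, with \<open>S\<close> all of the type \<open>'g\<close>, is the set of words modulo the least
  congruence that cancels adjacent inverse letters and deletes the relators in \<open>R\<close>.\<close>

type_synonym 'g word = "('g \<times> bool) list"

inductive word_eq :: "'g word set \<Rightarrow> 'g word \<Rightarrow> 'g word \<Rightarrow> bool" for R where
  refl: "word_eq R u u"
| sym: "word_eq R u v \<Longrightarrow> word_eq R v u"
| trans: "word_eq R u v \<Longrightarrow> word_eq R v w \<Longrightarrow> word_eq R u w"
| cancel: "word_eq R (u @ [(s, b), (s, \<not> b)] @ v) (u @ v)"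
| relator: "r \<in> R \<Longrightarrow> word_eq R (u @ r @ v) (u @ v)"

definition word_class :: "'g word set \<Rightarrow> 'g word \<Rightarrow> 'g word set" where
  "word_class R u = {v. word_eq R u v}"

definition presented_group :: "'g word set \<Rightarrow> 'g word set monoid" where
  "presented_group R =
    \<lparr> carrier = range (word_class R),
      mult = (\<lambda>X Y. {w. \<exists>u\<in>X. \<exists>v\<in>Y. word_eq R (u @ v) w}),
      one = word_class R [] \<rparr>"

definition generator :: "'g word set \<Rightarrow> 'g \<Rightarrow> 'g word set" where
  "generator R s = word_class R [(s, True)]"

fun word_value :: "('a, 'b) monoid_scheme \<Rightarrow> ('g \<Rightarrow> 'a) \<Rightarrow> 'g word \<Rightarrow> 'a" where
  "word_value K f [] = \<one>\<^bsub>K\<^esub>"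
| "word_value K f ((s, b) # w) = (if b then f s else inv\<^bsub>K\<^esub> (f s)) \<otimes>\<^bsub>K\<^esub> word_value K f w"

text \<open>The homomorphism from a presented group determined by the images of the generators. It is
  well defined when the images satisfy the relators, see \<open>presented_lift_hom\<close>.\<close>

definition presented_lift :: "('a, 'b) monoid_scheme \<Rightarrow> ('g \<Rightarrow> 'a) \<Rightarrow> 'g word set \<Rightarrow> 'a" where
  "presented_lift K f X = the_elem (word_value K f ` X)"

lemma word_eq_append:
  assumes "word_eq R u u'" shows "word_eq R (x @ u @ y) (x @ u' @ y)"
  using assms
proof induction
  case (cancel u s b v)
  show ?case using word_eq.cancel[of R "x @ u" s b "v @ y"] by simp
next
  case (relator r u v)
  then show ?case using word_eq.relator[of r R "x @ u" "v @ y"] by simp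
next
  case (sym u v)
  then show ?case using word_eq.sym by blast
next
  case (trans u v w)
  then show ?case using word_eq.trans by blast
qed (rule word_eq.refl)

lemma word_eq_append2:
  assumes "word_eq R u u'" "word_eq R v v'" shows "word_eq R (u @ v) (u' @ v')"
  using word_eq.trans word_eq_append[OF assms(1), of "[]" v] word_eq_append[OF assms(2), of u' "[]"]
  by fastforce

lemma word_class_eq_iff: "word_class R u = word_class R v \<longleftrightarrow> word_eq R u v"
  using word_eq.refl[of R] word_eq.sym[of R] word_eq.trans[of R]
  unfolding word_class_def set_eq_iff mem_Collect_eq by metis

lemma mult_word_class [simp]:
  "word_class R u \<otimes>\<^bsub>presented_group R\<^esub> word_class R v = word_class R (u @ v)"
proof -
  have "(\<exists>u'\<in>word_class R u. \<exists>v'\<in>word_class R v. word_eq R (u' @ v') w) \<longleftrightarrow> word_eq R (u @ v) w" for w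
    unfolding word_class_def bex_simps mem_Collect_eq Bex_def
    using word_eq_append2 word_eq.refl word_eq.trans by metis
  then show ?thesis by (simp add: presented_group_def) (simp add: word_class_def)
qed

lemma one_presented_group: "\<one>\<^bsub>presented_group R\<^esub> = word_class R []"
  and carrier_presented_group: "carrier (presented_group R) = range (word_class R)"
  by (simp_all add: presented_group_def)

definition word_inv :: "'g word \<Rightarrow> 'g word" where
  "word_inv w = rev (map (\<lambda>(s, b). (s, \<not> b)) w)"

lemma word_inv_left: "word_eq R (word_inv w @ w) []"
proof (induction w)
  case Nil
  show ?case by (simp add: word_inv_def word_eq.refl)
next
  case (Cons a w)
  obtain s b where a: "a = (s, b)" by (cases a)
  have "word_eq R (word_inv w @ [(s, \<not> b), (s, \<not> \<not> b)] @ w) (word_inv w @ w)"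
    by (rule word_eq.cancel)
  then have "word_eq R (word_inv (a # w) @ a # w) (word_inv w @ w)"
    by (simp add: a word_inv_def)
  then show ?case using Cons.IH by (rule word_eq.trans)
qed

lemma group_presented_group: "group (presented_group R)"
proof (rule groupI)
  fix x assume "x \<in> carrier (presented_group R)"
  then obtain u where u: "x = word_class R u" by (auto simp: carrier_presented_group)
  have "word_class R (word_inv u) \<otimes>\<^bsub>presented_group R\<^esub> x = \<one>\<^bsub>presented_group R\<^esub>"
    by (simp add: u one_presented_group word_class_eq_iff word_inv_left)
  then show "\<exists>y\<in>carrier (presented_group R). y \<otimes>\<^bsub>presented_group R\<^esub> x = \<one>\<^bsub>presented_group R\<^esub>"
    by (auto simp: carrier_presented_group)
qed (auto simp: carrier_presented_group one_presented_group)

context group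
begin

lemma word_value_closed: "range f \<subseteq> carrier G \<Longrightarrow> word_value G f w \<in> carrier G"
  by (induction w) (auto simp: image_subset_iff)

lemma word_value_append:
  "range f \<subseteq> carrier G \<Longrightarrow> word_value G f (u @ v) = word_value G f u \<otimes> word_value G f v"
proof (induction u)
  case (Cons a u)
  have "f (fst a) \<in> carrier G" using Cons.prems by auto
  then show ?case using Cons word_value_closed[OF Cons.prems]
    by (cases a) (auto simp: m_assoc)
qed (simp add: word_value_closed)

lemma word_value_cong:
  assumes f: "range f \<subseteq> carrier G" and R: "\<And>r. r \<in> R \<Longrightarrow> word_value G f r = \<one>"
    and "word_eq R u v"
  shows "word_value G f u = word_value G f v"
  using assms(3)
proof induction
  case (cancel u s b v)
  have "f s \<in> carrier G" using f by auto
  then have "word_value G f [(s, b), (s, \<not> b)] = \<one>" by (cases b) simp_all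
  then show ?case by (simp only: word_value_append[OF f] word_value_closed[OF f] l_one)
next
  case (relator r u v)
  then show ?case by (simp only: word_value_append[OF f] R word_value_closed[OF f] l_one)
qed simp_all

lemma presented_lift_word_class:
  assumes "range f \<subseteq> carrier G" "\<And>r. r \<in> R \<Longrightarrow> word_value G f r = \<one>"
  shows "presented_lift G f (word_class R u) = word_value G f u"
proof -
  have "word_value G f ` word_class R u = {word_value G f u}"
  proof (intro equalityI subsetI)
    show "x \<in> {word_value G f u}" if "x \<in> word_value G f ` word_class R u" for x
      using that word_value_cong[OF assms] by (auto simp: word_class_def)
    show "x \<in> word_value G f ` word_class R u" if "x \<in> {word_value G f u}" for x
      using that word_eq.refl[of R u] by (auto simp: word_class_def)
  qed
  then show ?thesis by (simp add: presented_lift_def)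
qed

lemma presented_lift_hom:
  assumes "range f \<subseteq> carrier G" "\<And>r. r \<in> R \<Longrightarrow> word_value G f r = \<one>"
  shows "presented_lift G f \<in> hom (presented_group R) G"
    and "presented_lift G f (generator R s) = f s"
proof -
  show "presented_lift G f \<in> hom (presented_group R) G"
    by (rule homI)
      (auto simp: carrier_presented_group presented_lift_word_class[OF assms]
        word_value_append[OF assms(1)] word_value_closed[OF assms(1)])
  have "f s \<in> carrier G" using assms(1) by auto
  then show "presented_lift G f (generator R s) = f s"
    by (simp add: generator_def presented_lift_word_class[OF assms])
qed

end

section \<open>The group \<open>PU(3,1)\<close>\<close>

definition herm_matrix :: "complex^4^4" where
  "herm_matrix = vector [vector [0, 0, 0, 1], vector [0, 1, 0, 0], vector [0, 0, 1, 0], vector [1, 0, 0, 0]]"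

definition herm :: "complex^4 \<Rightarrow> complex^4 \<Rightarrow> complex" where
  "herm z w = (\<Sum>i\<in>UNIV. cnj (w $ i) * (herm_matrix *v z) $ i)"

definition U31 :: "(complex^4^4) monoid" where
  "U31 = \<lparr> carrier = {A. \<forall>z w. herm (A *v z) (A *v w) = herm z w}, mult = (**), one = mat 1 \<rparr>"

definition scalars :: "(complex^4^4) set" where
  "scalars = {A \<in> carrier U31. \<exists>c. A = mat c}"

definition PU31 :: "(complex^4^4) set monoid" where
  "PU31 = U31 Mod scalars"

definition proj_class :: "complex^4^4 \<Rightarrow> (complex^4^4) set" where
  "proj_class A = scalars #>\<^bsub>U31\<^esub> A"

text \<open>The quotient topology, see \<open>quotient_map_PU31\<close>.\<close>

definition PU31_topology :: "(complex^4^4) set topology" where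
  "PU31_topology = topology (\<lambda>V. V \<subseteq> carrier PU31 \<and>
     openin (top_of_set (carrier U31)) {A \<in> carrier U31. proj_class A \<in> V})"

definition discrete_subgroup_PU31 :: "(complex^4^4) set set \<Rightarrow> bool" where
  "discrete_subgroup_PU31 \<Gamma> \<longleftrightarrow>
     subgroup \<Gamma> PU31 \<and> subtopology PU31_topology \<Gamma> = discrete_topology \<Gamma>"

lemma carrier_PU31: "carrier PU31 = proj_class ` carrier U31"
  by (simp add: PU31_def carrier_FactGroup proj_class_def[abs_def])

lemma openin_PU31_topology:
  "openin PU31_topology V \<longleftrightarrow> V \<subseteq> carrier PU31 \<and>
     openin (top_of_set (carrier U31)) {A \<in> carrier U31. proj_class A \<in> V}"
proof -
  define T where "T = top_of_set (carrier U31)"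
  define P where "P V \<longleftrightarrow> V \<subseteq> carrier PU31 \<and>
     openin T {A \<in> carrier U31. proj_class A \<in> V}" for V
  have "istopology P"
    unfolding istopology_def
  proof (intro conjI allI impI)
    fix S S' assume S: "P S" "P S'"
    have eq: "{A \<in> carrier U31. proj_class A \<in> S \<inter> S'} =
      {A \<in> carrier U31. proj_class A \<in> S} \<inter> {A \<in> carrier U31. proj_class A \<in> S'}" by blast
    have "openin T {A \<in> carrier U31. proj_class A \<in> S \<inter> S'}"
      unfolding eq by (rule openin_Int) (use S in \<open>simp_all only: P_def\<close>)
    moreover have "S \<inter> S' \<subseteq> carrier PU31" using S unfolding P_def by blast
    ultimately show "P (S \<inter> S')" unfolding P_def by blast
  next
    fix \<K> assume K: "\<forall>K\<in>\<K>. P K"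
    have eq: "{A \<in> carrier U31. proj_class A \<in> \<Union>\<K>} =
      \<Union>((\<lambda>K. {A \<in> carrier U31. proj_class A \<in> K}) ` \<K>)" by blast
    have "openin T {A \<in> carrier U31. proj_class A \<in> \<Union>\<K>}"
      unfolding eq by (rule openin_Union) (use K in \<open>auto simp: P_def\<close>)
    moreover have "\<Union>\<K> \<subseteq> carrier PU31" using K unfolding P_def by blast
    ultimately show "P (\<Union>\<K>)" unfolding P_def by blast
  qed
  then have "openin (topology P) = P" by (rule topology_inverse')
  moreover have "PU31_topology = topology P"
    unfolding PU31_topology_def by (rule arg_cong[of _ _ topology], rule ext) (simp only: P_def T_def)
  ultimately have "openin PU31_topology V \<longleftrightarrow> P V" by metis
  then show ?thesis unfolding P_def T_def .
qed

lemma quotient_map_PU31: "quotient_map (top_of_set (carrier U31)) PU31_topology proj_class"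
proof -
  have "{A \<in> carrier U31. proj_class A \<in> carrier PU31} = carrier U31"
    unfolding carrier_PU31 by blast
  moreover have "openin (top_of_set (carrier U31)) (carrier U31)"
    by (rule openin_subtopology_self)
  ultimately have "openin PU31_topology (carrier PU31)"
    by (simp only: openin_PU31_topology order_refl simp_thms)
  moreover have "topspace PU31_topology \<subseteq> carrier PU31"
    using openin_topspace[of PU31_topology] unfolding openin_PU31_topology by (rule conjunct1)
  ultimately have top: "topspace PU31_topology = carrier PU31"
    by (intro subset_antisym openin_subset)
  show ?thesis
    unfolding quotient_map_def top topspace_euclidean_subtopology
    by (simp only: openin_PU31_topology carrier_PU31 simp_thms) simp
qed

lemma herm_eq: "herm z w = z$4 * cnj (w$1) + z$2 * cnj (w$2) + z$3 * cnj (w$3) + z$1 * cnj (w$4)"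
  by (simp add: herm_def herm_matrix_def matrix_vector_mult_def sum_4 vector_def)

lemma herm_linear:
  "herm (x + y) w = herm x w + herm y w" "herm (x - y) w = herm x w - herm y w"
  "herm (- x) w = - herm x w" "herm (c *s x) w = c * herm x w"
  "herm w (x + y) = herm w x + herm w y" "herm w (x - y) = herm w x - herm w y"
  "herm w (- x) = - herm w x" "herm w (c *s x) = cnj c * herm w x"
  by (simp_all add: herm_eq algebra_simps)

lemma cnj_herm: "cnj (herm z w) = herm w z"
  by (simp add: herm_eq algebra_simps)

lemma herm_nondegenerate:
  assumes "\<And>w. herm z w = 0" shows "z = 0"
proof -
  have "z $ 4 = 0" "z $ 2 = 0" "z $ 3 = 0" "z $ 1 = 0"
    using assms[of "axis 1 1"] assms[of "axis 2 1"] assms[of "axis 3 1"] assms[of "axis 4 1"]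
    by (simp_all add: herm_eq axis_def)
  then show ?thesis by (simp add: vec_eq_iff forall_4)
qed

lemma group_U31: "group U31"
proof (rule groupI)
  fix A assume "A \<in> carrier U31"
  then have A: "\<And>z w. herm (A *v z) (A *v w) = herm z w" by (simp add: U31_def)
  have "z = 0" if "A *v z = 0" for z
  proof (rule herm_nondegenerate)
    fix w
    have "herm z w = herm 0 (A *v w)" using A[of z w] that by simp
    then show "herm z w = 0" by (simp add: herm_eq)
  qed
  then obtain B where B: "B ** A = mat 1" using matrix_left_invertible_ker[of A] by blast
  then have B': "A ** B = mat 1" by (simp add: matrix_left_right_inverse)
  have "herm (B *v z) (B *v w) = herm z w" for z w
    using A[of "B *v z" "B *v w", symmetric]
    by (simp only: matrix_vector_mul_assoc B' matrix_vector_mul_lid)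
  then show "\<exists>B\<in>carrier U31. B \<otimes>\<^bsub>U31\<^esub> A = \<one>\<^bsub>U31\<^esub>"
    using B by (intro bexI[of _ B]) (simp_all add: U31_def)
next
  show "A \<otimes>\<^bsub>U31\<^esub> B \<in> carrier U31" if "A \<in> carrier U31" "B \<in> carrier U31" for A B
    using that by (simp add: U31_def matrix_vector_mul_assoc[symmetric])
qed (simp_all add: U31_def matrix_mul_assoc)

lemma mat_vector_mult: "mat c *v z = c *s (z :: complex^4)"
  by (simp add: vec_eq_iff forall_4 matrix_vector_mult_def mat_def sum_4)

lemma mat_mult_commute: "mat c ** A = A ** mat c" for A :: "complex^4^4"
  by (simp add: matrix_eq matrix_vector_mul_assoc[symmetric] mat_vector_mult vector_scalar_commute)

lemma mat_mult_mat: "mat c ** mat d = (mat (c * d) :: complex^4^4)"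
  by (simp add: matrix_eq matrix_vector_mul_assoc[symmetric] mat_vector_mult)

lemma scalars_normal: "scalars \<lhd> U31"
proof -
  interpret U: group U31 by (rule group_U31)
  have sub: "x \<in> carrier U31" if "x \<in> scalars" for x using that by (simp add: scalars_def)
  have comm: "x \<otimes>\<^bsub>U31\<^esub> A = A \<otimes>\<^bsub>U31\<^esub> x" if "x \<in> scalars" for x A
    using that mat_mult_commute by (auto simp: scalars_def U31_def)
  have "subgroup scalars U31"
  proof (rule U.subgroupI)
    show "scalars \<subseteq> carrier U31" using sub by blast
    have "\<one>\<^bsub>U31\<^esub> \<in> scalars" by (auto simp: scalars_def U31_def)
    then show "scalars \<noteq> {}" by blast
    fix a assume a: "a \<in> scalars"
    then obtain c where c: "a = mat c" by (auto simp: scalars_def)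
    let ?b = "inv\<^bsub>U31\<^esub> a"
    have b: "mat c ** ?b = mat 1"
      using U.r_inv[OF sub[OF a]] by (simp add: c U31_def)
    have "c \<noteq> 0"
    proof
      assume "c = 0"
      then have "mat c ** ?b = 0" by (simp add: matrix_eq matrix_vector_mul_assoc[symmetric] mat_vector_mult)
      then have "(mat 1 :: complex^4^4) $ 1 $ 1 = 0" using b by simp
      then show False by (simp add: mat_def)
    qed
    then have "mat (1 / c) ** mat c = (mat 1 :: complex^4^4)" by (simp add: mat_mult_mat)
    then have "?b = mat (1 / c) ** (mat c ** ?b)"
      by (simp only: matrix_mul_assoc matrix_mul_lid)
    then have "?b = mat (1 / c)" unfolding b by (simp only: matrix_mul_rid)
    then show "?b \<in> scalars" using U.inv_closed[OF sub[OF a]] unfolding scalars_def by blast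
    fix b assume b: "b \<in> scalars"
    then obtain d where d: "b = mat d" by (auto simp: scalars_def)
    have "a \<otimes>\<^bsub>U31\<^esub> b = mat (c * d)" by (simp add: c d U31_def mat_mult_mat)
    then show "a \<otimes>\<^bsub>U31\<^esub> b \<in> scalars"
      using U.m_closed[OF sub[OF a] sub[OF b]] unfolding scalars_def by blast
  qed
  then show ?thesis
  proof (rule U.normal_invI)
    fix x h assume x: "x \<in> carrier U31" and h: "h \<in> scalars"
    have "x \<otimes>\<^bsub>U31\<^esub> h \<otimes>\<^bsub>U31\<^esub> inv\<^bsub>U31\<^esub> x = h"
      unfolding comm[OF h, of x, symmetric]
      using x sub[OF h] by (simp add: U.m_assoc)
    then show "x \<otimes>\<^bsub>U31\<^esub> h \<otimes>\<^bsub>U31\<^esub> inv\<^bsub>U31\<^esub> x \<in> scalars" using h by simp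
  qed
qed

lemma group_PU31: "group PU31"
  unfolding PU31_def by (rule normal.factorgroup_is_group[OF scalars_normal])

lemma proj_class_hom: "proj_class \<in> hom U31 PU31"
  using normal.r_coset_hom_Mod[OF scalars_normal] by (simp add: PU31_def proj_class_def[abs_def])

definition complex_reflection :: "complex^4 \<Rightarrow> complex^4^4" where
  "complex_reflection n = matrix (\<lambda>z. - z + (2 * herm z n) *s n)"

lemma complex_reflection_apply: "complex_reflection n *v z = - z + (2 * herm z n) *s n"
  unfolding complex_reflection_def
  by (rule matrix_works) (unfold_locales, auto simp: vec_eq_iff herm_linear algebra_simps)

lemma complex_reflection_in_U31:
  "herm n n = 1 \<Longrightarrow> complex_reflection n \<in> carrier U31"
  by (simp add: U31_def complex_reflection_apply herm_linear cnj_herm algebra_simps)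

section \<open>The group \<open>G\<close> and the representations \<open>\<rho>\<^bsub>(h,t)\<^esub>\<close>\<close>

datatype gen = \<iota>1 | \<iota>2 | \<iota>3 | \<iota>4

definition word_pow :: "gen list \<Rightarrow> nat \<Rightarrow> gen word" where
  "word_pow ss k = concat (replicate k (map (\<lambda>s. (s, True)) ss))"

definition relators :: "gen word set" where
  "relators = {word_pow [\<iota>1] 2, word_pow [\<iota>2] 2, word_pow [\<iota>3] 2, word_pow [\<iota>4] 2,
     word_pow [\<iota>1, \<iota>3] 2, word_pow [\<iota>1, \<iota>4] 3, word_pow [\<iota>2, \<iota>4] 2}"

definition G :: "gen word set monoid" where
  "G = presented_group relators"

definition parameter_space :: "(real \<times> real) set" where
  "parameter_space = {(h, t). 1 \<le> h \<and> 0 \<le> t \<and> t \<le> pi \<and> t \<le> arccos (- (3 * h\<^sup>2 + 1) / (4 * h\<^sup>2))}"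

fun polar_vector :: "real \<Rightarrow> real \<Rightarrow> gen \<Rightarrow> complex^4" where
  "polar_vector h t \<iota>1 = vector [0, 1, 0, 0]"
| "polar_vector h t \<iota>2 = vector [1, -1, 0, 0]"
| "polar_vector h t \<iota>3 = vector [- 1 / (2 * of_real h), 0, 0, - of_real h]"
| "polar_vector h t \<iota>4 = vector
     [(4 * (of_real h)\<^sup>2 + cis (- t)) / (4 * (of_real h)\<^sup>2),
      - cis (- t) / 2,
      of_real (sqrt (4 * h\<^sup>2 * cos t + 3 * h\<^sup>2 + 1)) / (2 * of_real h),
      - cis (- t) / 2]"

definition \<rho> :: "real \<Rightarrow> real \<Rightarrow> gen word set \<Rightarrow> (complex^4^4) set" where
  "\<rho> h t = presented_lift PU31 (\<lambda>s. proj_class (complex_reflection (polar_vector h t s)))"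

definition discrete_faithful_rep :: "(gen word set \<Rightarrow> (complex^4^4) set) \<Rightarrow> bool" where
  "discrete_faithful_rep \<phi> \<longleftrightarrow>
     \<phi> \<in> hom G PU31 \<and> discrete_subgroup_PU31 (\<phi> ` carrier G) \<and> inj_on \<phi> (carrier G)"

lemma vector_4:
  "(vector [a, b, c, d] :: complex^4) $ 1 = a" "(vector [a, b, c, d] :: complex^4) $ 2 = b"
  "(vector [a, b, c, d] :: complex^4) $ 3 = c" "(vector [a, b, c, d] :: complex^4) $ 4 = d"
  by (simp_all add: vector_def)

lemma discriminant_nonneg:
  assumes "(h, t) \<in> parameter_space"
  shows "0 \<le> 4 * h\<^sup>2 * cos t + 3 * h\<^sup>2 + 1"
proof -
  let ?x = "- (3 * h\<^sup>2 + 1) / (4 * h\<^sup>2)"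
  have h: "1 \<le> h" and t: "0 \<le> t" "t \<le> arccos ?x" using assms by (auto simp: parameter_space_def)
  have h2: "1 \<le> h\<^sup>2" using h by (simp add: one_le_power)
  have x: "-1 \<le> ?x" "?x \<le> 1" using h2 by (simp_all add: le_divide_eq divide_le_eq)
  have "cos (arccos ?x) \<le> cos t"
    using t arccos_ubound[OF x] by (intro cos_monotone_0_pi_le) auto
  then have "?x \<le> cos t" using x by (simp add: cos_arccos)
  moreover have "0 < 4 * h\<^sup>2" using h by simp
  ultimately have "- (3 * h\<^sup>2 + 1) \<le> cos t * (4 * h\<^sup>2)" by (simp only: pos_divide_le_eq)
  then show ?thesis by (simp add: algebra_simps)
qed

lemma herm_polar_vector:
  assumes "(h, t) \<in> parameter_space"
  defines "n \<equiv> polar_vector h t"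
  shows "herm (n s) (n s) = 1" "herm (n \<iota>1) (n \<iota>3) = 0" "herm (n \<iota>2) (n \<iota>4) = 0"
    "herm (n \<iota>1) (n \<iota>4) * herm (n \<iota>4) (n \<iota>1) = 1 / 4"
proof -
  have h: "h \<noteq> 0" using assms by (auto simp: parameter_space_def)
  have D: "(sqrt (4 * h\<^sup>2 * cos t + 3 * h\<^sup>2 + 1))\<^sup>2 = 4 * h\<^sup>2 * cos t + 3 * h\<^sup>2 + 1"
    using discriminant_nonneg[OF assms(1)] by simp
  have cc: "cis t * cis (- t) = 1" by (simp add: cis_mult)
  have c2: "cis t + cis (- t) = 2 * of_real (cos t)" by (simp add: complex_eq_iff)
  show "herm (n \<iota>1) (n \<iota>3) = 0" "herm (n \<iota>2) (n \<iota>4) = 0"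
    by (simp_all add: n_def herm_eq vector_4)
  show "herm (n \<iota>1) (n \<iota>4) * herm (n \<iota>4) (n \<iota>1) = 1 / 4"
    using cc by (simp add: n_def herm_eq vector_4 cis_cnj)
  show "herm (n s) (n s) = 1"
  proof (cases s)
    case \<iota>4
    define D where "D = sqrt (4 * h\<^sup>2 * cos t + 3 * h\<^sup>2 + 1)"
    define H where "H = complex_of_real h"
    define e where "e = cis (- t)"
    define e' where "e' = cis t"
    have H: "H \<noteq> 0" using h by (simp add: H_def)
    have ee: "e' * e = 1" using cc by (simp add: e_def e'_def)
    have D2: "complex_of_real D * complex_of_real D = 2 * H\<^sup>2 * (e + e') + 3 * H\<^sup>2 + 1"
    proof -
      have "complex_of_real (D\<^sup>2) = of_real (4 * h\<^sup>2 * cos t + 3 * h\<^sup>2 + 1)"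
        using D by (simp add: D_def)
      then show ?thesis using c2 by (simp add: H_def e_def e'_def power2_eq_square algebra_simps)
    qed
    have "herm (n s) (n s) =
      - e / 2 * ((4 * H\<^sup>2 + e') / (4 * H\<^sup>2)) + (e / 2) * (e' / 2)
      + (of_real D * of_real D) / (4 * H\<^sup>2) + (4 * H\<^sup>2 + e) / (4 * H\<^sup>2) * (- e' / 2)"
      by (simp add: n_def \<iota>4 herm_eq vector_4 cis_cnj D_def H_def e_def e'_def power2_eq_square)
    also have "\<dots> = 1"
      unfolding D2 using H ee by (simp add: divide_simps) algebra
    finally show ?thesis .
  qed (use h in \<open>simp_all add: n_def herm_eq vector_4\<close>)
qed

lemma complex_reflection_mult:
  assumes "herm n n = 1" shows "complex_reflection n ** complex_reflection n = mat 1"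
proof -
  have "complex_reflection n *v (complex_reflection n *v z) = z" for z
    unfolding complex_reflection_apply herm_linear assms
    by (simp add: vec_eq_iff algebra_simps)
  then show ?thesis by (simp add: matrix_eq matrix_vector_mul_assoc[symmetric])
qed

lemma complex_reflection_orthogonal:
  assumes "herm n n = 1" "herm m m = 1" "herm n m = 0"
  shows "complex_reflection n ** (complex_reflection m **
    (complex_reflection n ** complex_reflection m)) = mat 1"
proof -
  have mn: "herm m n = 0" using assms(3) cnj_herm[of n m] by simp
  have "complex_reflection n *v (complex_reflection m *v z) =
    complex_reflection m *v (complex_reflection n *v z)" for z
    unfolding complex_reflection_apply herm_linear assms mn
    by (simp add: vec_eq_iff algebra_simps)
  then have "complex_reflection n ** complex_reflection m = complex_reflection m ** complex_reflection n"
    by (simp add: matrix_eq matrix_vector_mul_assoc[symmetric])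
  then show ?thesis
    using complex_reflection_mult[OF assms(1)] complex_reflection_mult[OF assms(2)]
    by (metis matrix_mul_assoc matrix_mul_lid)
qed

lemma complex_reflection_braid:
  assumes "herm n n = 1" "herm m m = 1" "herm n m * herm m n = 1 / 4"
  shows "complex_reflection n ** (complex_reflection m ** (complex_reflection n **
    (complex_reflection m ** (complex_reflection n ** complex_reflection m)))) = mat 1"
proof -
  have "complex_reflection n *v (complex_reflection m *v (complex_reflection n *v z)) =
    complex_reflection m *v (complex_reflection n *v (complex_reflection m *v z))" for z
  proof -
    define p q a b where "p = herm n m" and "q = herm m n" and "a = herm z n" and "b = herm z m"
    note defs = p_def[symmetric] q_def[symmetric] a_def[symmetric] b_def[symmetric]
    have pq: "4 * (p * q) = 1" unfolding p_def q_def assms(3) by simp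
    have alg: "- (- (- x + 2 * a * y) + 2 * (- b + 2 * a * p) * w) +
        2 * (- (- a + 2 * a * 1) + 2 * (- b + 2 * a * p) * q) * y =
      - (- (- x + 2 * b * w) + 2 * (- a + 2 * b * q) * y) +
        2 * (- (- b + 2 * b * 1) + 2 * (- a + 2 * b * q) * p) * w" for x y w :: complex
      using pq by algebra
    show ?thesis
      unfolding complex_reflection_apply herm_linear assms(1,2) defs vec_eq_iff
        vector_add_component vector_uminus_component vector_smult_component
      by (intro allI alg)
  qed
  then have eq: "complex_reflection n ** (complex_reflection m ** complex_reflection n) =
    complex_reflection m ** (complex_reflection n ** complex_reflection m)"
    by (simp add: matrix_eq matrix_vector_mul_assoc[symmetric])
  have "complex_reflection n ** (complex_reflection m ** (complex_reflection n **
      (complex_reflection m ** (complex_reflection n ** complex_reflection m)))) =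
    (complex_reflection n ** (complex_reflection m ** complex_reflection n)) **
      (complex_reflection m ** (complex_reflection n ** complex_reflection m))"
    by (simp only: matrix_mul_assoc)
  also have "\<dots> = complex_reflection n ** (complex_reflection m ** (complex_reflection n **
      complex_reflection n) ** complex_reflection m) ** complex_reflection n"
    unfolding eq[symmetric] by (simp only: matrix_mul_assoc)
  also have "\<dots> = mat 1"
    by (simp add: complex_reflection_mult assms)
  finally show ?thesis .
qed

text \<open>\<open>\<rho>\<close> is indeed well defined on the parameter space.\<close>

lemma \<rho>_hom:
  assumes "(h, t) \<in> parameter_space"
  shows "\<rho> h t \<in> hom G PU31"
    and "\<rho> h t (generator relators s) = proj_class (complex_reflection (polar_vector h t s))"
proof -
  interpret P: group PU31 by (rule group_PU31)
  let ?I = "\<lambda>s. complex_reflection (polar_vector h t s)"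
  note n = herm_polar_vector[OF assms]
  have I: "?I s \<in> carrier U31" for s using n(1) by (rule complex_reflection_in_U31)
  have rng: "range (\<lambda>s. proj_class (?I s)) \<subseteq> carrier PU31" using I by (auto simp: carrier_PU31)
  have one: "\<one>\<^bsub>PU31\<^esub> = proj_class (mat 1)"
    using hom_one[OF proj_class_hom group_U31 group_PU31] by (simp add: U31_def)
  have cl: "A ** B \<in> carrier U31" if "A \<in> carrier U31" "B \<in> carrier U31" for A B
  proof -
    have "A ** B = A \<otimes>\<^bsub>U31\<^esub> B" by (simp add: U31_def)
    then show ?thesis using monoid.m_closed[OF group.is_monoid[OF group_U31] that] by (simp only:)
  qed
  have mu: "proj_class A \<otimes>\<^bsub>PU31\<^esub> proj_class B = proj_class (A ** B)"
    if "A \<in> carrier U31" "B \<in> carrier U31" for A B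
    using hom_mult[OF proj_class_hom that] by (simp add: U31_def)
  have mat1: "mat 1 \<in> carrier U31" by (simp add: U31_def)
  have lift: "word_value PU31 (\<lambda>s. proj_class (?I s)) (map (\<lambda>s. (s, True)) ss) =
      proj_class (foldr (\<lambda>s A. ?I s ** A) ss (mat 1))"
    and lift_cl: "foldr (\<lambda>s A. ?I s ** A) ss (mat 1) \<in> carrier U31" for ss
    by (induction ss) (simp_all only: list.map foldr.simps comp_apply id_apply word_value.simps
        if_True one mu I cl mat1)
  have pow: "word_value PU31 (\<lambda>s. proj_class (?I s)) (word_pow ss k) =
      proj_class (foldr (\<lambda>s A. ?I s ** A) (concat (replicate k ss)) (mat 1))" for ss k
    unfolding word_pow_def by (simp only: lift[symmetric] map_concat map_replicate)
  have val: "foldr (\<lambda>s A. ?I s ** A) (concat (replicate k ss)) (mat 1) = mat 1"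
    if "(ss, k) \<in> {([\<iota>1], 2), ([\<iota>2], 2), ([\<iota>3], 2), ([\<iota>4], 2),
        ([\<iota>1, \<iota>3], 2), ([\<iota>1, \<iota>4], 3), ([\<iota>2, \<iota>4], 2)}" for ss k
    using that
    by (auto simp: numeral_2_eq_2 numeral_3_eq_3 n complex_reflection_mult
        complex_reflection_orthogonal complex_reflection_braid simp del: polar_vector.simps)
  have rel: "word_value PU31 (\<lambda>s. proj_class (?I s)) r = \<one>\<^bsub>PU31\<^esub>" if "r \<in> relators" for r
    using that unfolding relators_def one insert_iff empty_iff
    by (elim disjE) (simp_all only: pow val insert_iff simp_thms)
  show "\<rho> h t \<in> hom G PU31"
    unfolding \<rho>_def G_def by (rule P.presented_lift_hom(1)[OF rng rel])
  show "\<rho> h t (generator relators s) = proj_class (?I s)"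
    unfolding \<rho>_def by (rule P.presented_lift_hom(2)[OF rng rel])
qed

end

theory Submission
  imports Defs
begin

text \<open>
  The group is the Coxeter group with diagram \<open>\<iota>3 - \<iota>1 - \<iota>4 - \<iota>2\<close>, that is, the amalgam
  \<open>\<langle>\<iota>3, \<iota>1\<rangle> *\<^bsub>\<langle>\<iota>1\<rangle>\<^esub> \<langle>\<iota>1, \<iota>4\<rangle> *\<^bsub>\<langle>\<iota>4\<rangle>\<^esub> \<langle>\<iota>4, \<iota>2\<rangle>\<close> whose middle factor is the symmetric group \<open>S\<^sub>3\<close>. It plays
  ping-pong on the negative cone with two closed half-spaces bounded by bisectors: \<open>K\<close>, which is
  \<open>\<iota>1\<close>-invariant and contains the \<open>\<iota>3\<close>-image of its complement, and \<open>L\<close>, which is \<open>\<iota>4\<close>-invariant and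
  contains the \<open>\<iota>2\<close>-image of its complement. All that is needed is that the six \<open>S\<^sub>3\<close>-translates of
  \<open>K\<close> and \<open>L\<close> are pairwise disjoint, which reduces to four pairs. The pair \<open>L, \<iota>1 L\<close> meets at the
  parabolic fixed point of \<open>\<iota>1 \<iota>2\<close> on the boundary, but \<open>\<langle>\<iota>1, \<iota>2, \<iota>4\<rangle>\<close> is the same group
  \<open>PGL(2,\<int>)\<close>, up to conjugation, for all parameters, and this pair is handled by an exact identity.
  For the other three pairs a positive combination of the defining forms and the Hermitian form is
  positive definite at \<open>(\<surd>2, arccos (-7/8))\<close>, hence nearby. Finally, an open set avoiding the six
  translates on which \<open>S\<^sub>3\<close> acts freely is moved off itself by every nontrivial element, which gives
  discreteness and faithfulness at once.
\<close>

section \<open>Normal forms and ping-pong\<close>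

definition pos_word :: "gen list \<Rightarrow> gen word" where
  "pos_word ss = map (\<lambda>s. (s, True)) ss"

text \<open>Every generator is an involution, so lists without inverse letters already represent all
  elements of \<open>G\<close>.\<close>

definition cox_eq :: "gen list \<Rightarrow> gen list \<Rightarrow> bool" where
  "cox_eq ss ts \<longleftrightarrow> word_eq relators (pos_word ss) (pos_word ts)"

lemma pos_word_simps [simp]:
  "pos_word [] = []" "pos_word (s # ss) = (s, True) # pos_word ss"
  "pos_word (ss @ ts) = pos_word ss @ pos_word ts"
  by (simp_all add: pos_word_def)

lemma cox_eq_refl [simp]: "cox_eq u u"
  by (simp add: cox_eq_def word_eq.refl)

lemma cox_eq_sym: "cox_eq u v \<Longrightarrow> cox_eq v u"
  by (simp add: cox_eq_def word_eq.sym)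

lemma cox_eq_trans [trans]: "cox_eq u v \<Longrightarrow> cox_eq v w \<Longrightarrow> cox_eq u w"
  unfolding cox_eq_def by (rule word_eq.trans)

lemma cox_eq_append: "cox_eq u u' \<Longrightarrow> cox_eq v v' \<Longrightarrow> cox_eq (u @ v) (u' @ v')"
  by (simp add: cox_eq_def word_eq_append2)

lemma cox_eq_Cons: "cox_eq u v \<Longrightarrow> cox_eq (s # u) (s # v)"
  using cox_eq_append[of "[s]" "[s]" u v] by simp

lemma cox_eq_relator:
  assumes "word_pow ss k \<in> relators"
  shows "cox_eq (concat (replicate k ss)) []"
proof -
  have "word_pow ss k = pos_word (concat (replicate k ss))"
    by (simp add: word_pow_def pos_word_def map_concat map_replicate)
  then show ?thesis
    using word_eq.relator[OF assms, of "[]" "[]"] by (simp add: cox_eq_def)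
qed

lemma cox_eq_square: "cox_eq (s # s # u) u"
proof -
  have "word_pow [s] 2 \<in> relators" by (cases s) (simp_all add: relators_def)
  from cox_eq_append[OF cox_eq_relator[OF this] cox_eq_refl[of u]]
  show ?thesis by (simp add: numeral_2_eq_2)
qed

lemma cox_eq_rev: "cox_eq (u @ rev u @ v) v"
proof (induction u arbitrary: v)
  case (Cons s u)
  have "cox_eq (s # (u @ rev u @ (s # v))) (s # s # v)"
    by (rule cox_eq_Cons) (rule Cons.IH)
  from cox_eq_trans[OF this cox_eq_square] show ?case by simp
qed simp

text \<open>Reversal inverts a word in involutions. Splitting a relator into two halves thus yields
  a commutation or braid rule.\<close>

lemma cox_eq_swap: assumes "cox_eq (u @ v) []" shows "cox_eq u (rev v)"
proof -
  have "cox_eq (u @ v @ rev v @ []) (u @ [])"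
    by (rule cox_eq_append[OF cox_eq_refl cox_eq_rev])
  then have "cox_eq u ((u @ v) @ rev v)" by (simp add: cox_eq_sym)
  also have "cox_eq ((u @ v) @ rev v) ([] @ rev v)"
    by (rule cox_eq_append[OF assms cox_eq_refl])
  finally show ?thesis by simp
qed

lemma cox_eq_braids:
  "cox_eq (\<iota>3 # \<iota>1 # u) (\<iota>1 # \<iota>3 # u)" "cox_eq (\<iota>2 # \<iota>4 # u) (\<iota>4 # \<iota>2 # u)"
  "cox_eq (\<iota>4 # \<iota>1 # \<iota>4 # u) (\<iota>1 # \<iota>4 # \<iota>1 # u)"
proof -
  have r: "word_pow [\<iota>1, \<iota>3] 2 \<in> relators" "word_pow [\<iota>2, \<iota>4] 2 \<in> relators"
    "word_pow [\<iota>1, \<iota>4] 3 \<in> relators" by (simp_all add: relators_def)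
  have "cox_eq [\<iota>1, \<iota>3] [\<iota>3, \<iota>1]" "cox_eq [\<iota>2, \<iota>4] [\<iota>4, \<iota>2]"
    "cox_eq [\<iota>1, \<iota>4, \<iota>1] [\<iota>4, \<iota>1, \<iota>4]"
    using cox_eq_swap[of "[\<iota>1, \<iota>3]" "[\<iota>1, \<iota>3]"] cox_eq_swap[of "[\<iota>2, \<iota>4]" "[\<iota>2, \<iota>4]"]
      cox_eq_swap[of "[\<iota>1, \<iota>4, \<iota>1]" "[\<iota>4, \<iota>1, \<iota>4]"]
      r[THEN cox_eq_relator] by (simp_all add: numeral_2_eq_2 numeral_3_eq_3)
  from this[THEN cox_eq_append, OF cox_eq_refl[of u]]
  show "cox_eq (\<iota>3 # \<iota>1 # u) (\<iota>1 # \<iota>3 # u)" "cox_eq (\<iota>2 # \<iota>4 # u) (\<iota>4 # \<iota>2 # u)"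
    "cox_eq (\<iota>4 # \<iota>1 # \<iota>4 # u) (\<iota>1 # \<iota>4 # \<iota>1 # u)"
    by (simp_all add: cox_eq_sym)
qed

lemma word_eq_pos_word: "word_eq relators w (pos_word (map fst w))"
proof (induction w)
  case (Cons a w)
  obtain s b where a: "a = (s, b)" by (cases a)
  have "word_eq relators [(s, b)] [(s, True)]"
  proof (cases b)
    case False
    have "word_eq relators ([] @ [(s, False), (s, \<not> False)] @ [(s, True)]) ([] @ [(s, True)])"
      by (rule word_eq.cancel)
    then have "word_eq relators ([(s, False)] @ [(s, True), (s, True)]) [(s, True)]" by simp
    moreover have "word_eq relators ([(s, False)] @ [(s, True), (s, True)]) ([(s, False)] @ [])"
      using cox_eq_square[of s "[]"] by (intro word_eq_append2[OF word_eq.refl]) (simp add: cox_eq_def)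
    ultimately have "word_eq relators ([(s, False)] @ []) [(s, True)]"
      using word_eq.trans[OF word_eq.sym] by blast
    then show ?thesis using False by simp
  qed (simp add: word_eq.refl)
  from word_eq_append2[OF this Cons.IH] show ?case by (simp add: a)
qed (simp add: word_eq.refl)

text \<open>Representatives of \<open>\<langle>\<iota>1, \<iota>4\<rangle> \<cong> S\<^sub>3\<close>.\<close>

definition S3_words :: "gen list set" where
  "S3_words = {[], [\<iota>1], [\<iota>4], [\<iota>1, \<iota>4], [\<iota>4, \<iota>1], [\<iota>1, \<iota>4, \<iota>1]}"

lemma S3_words_Cons:
  assumes "x = \<iota>1 \<or> x = \<iota>4" "s \<in> S3_words"
  shows "\<exists>s'\<in>S3_words. cox_eq (x # s) s'"
proof -
  have 1: "cox_eq [\<iota>1, \<iota>1] []" "cox_eq [\<iota>1, \<iota>1, \<iota>4] [\<iota>4]" "cox_eq [\<iota>1, \<iota>1, \<iota>4, \<iota>1] [\<iota>4, \<iota>1]"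
    "cox_eq [\<iota>4, \<iota>4] []" "cox_eq [\<iota>4, \<iota>4, \<iota>1] [\<iota>1]" by (rule cox_eq_square)+
  have 2: "cox_eq [\<iota>4, \<iota>1, \<iota>4] [\<iota>1, \<iota>4, \<iota>1]" by (rule cox_eq_braids)
  have "cox_eq [\<iota>4, \<iota>1, \<iota>4, \<iota>1] [\<iota>1, \<iota>4, \<iota>1, \<iota>1]" by (rule cox_eq_braids)
  also have "cox_eq [\<iota>1, \<iota>4, \<iota>1, \<iota>1] [\<iota>1, \<iota>4]"
    by (intro cox_eq_Cons cox_eq_square)
  finally have 3: "cox_eq [\<iota>4, \<iota>1, \<iota>4, \<iota>1] [\<iota>1, \<iota>4]" .
  have members: "[] \<in> S3_words" "[\<iota>1] \<in> S3_words" "[\<iota>4] \<in> S3_words" "[\<iota>1, \<iota>4] \<in> S3_words"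
    "[\<iota>4, \<iota>1] \<in> S3_words" "[\<iota>1, \<iota>4, \<iota>1] \<in> S3_words" by (simp_all add: S3_words_def)
  from assms(2) consider "s = []" | "s = [\<iota>1]" | "s = [\<iota>4]" | "s = [\<iota>1, \<iota>4]" | "s = [\<iota>4, \<iota>1]"
    | "s = [\<iota>1, \<iota>4, \<iota>1]" by (auto simp: S3_words_def)
  then show ?thesis
    using assms(1) 1 2 3 members cox_eq_refl by cases blast+
qed

lemma S3_words_append:
  assumes "u \<in> S3_words" "s \<in> S3_words"
  shows "\<exists>s'\<in>S3_words. cox_eq (u @ s) s'"
proof -
  have "set u \<subseteq> {\<iota>1, \<iota>4}" using assms(1) by (auto simp: S3_words_def)
  then show ?thesis
  proof (induction u)
    case Nil
    show ?case using assms(2) by (intro bexI[of _ s]) simp_all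
  next
    case (Cons x u)
    then obtain s' where s': "s' \<in> S3_words" "cox_eq (u @ s) s'" by auto
    then obtain s'' where "s'' \<in> S3_words" "cox_eq (x # s') s''"
      using S3_words_Cons[of x s'] Cons.prems by auto
    then show ?case using cox_eq_Cons[OF s'(2), of x] cox_eq_trans by auto
  qed
qed

lemma S3_words_rev: "s \<in> S3_words \<Longrightarrow> rev s \<in> S3_words"
  by (auto simp: S3_words_def)

text \<open>The excluded \<open>s\<close> are those commuting with the preceding letter, which could be cancelled
  through them.\<close>

inductive c_reduced and b_reduced where
  c1: "s \<in> S3_words \<Longrightarrow> c_reduced (\<iota>3 # s)"
| cb: "s \<in> S3_words \<Longrightarrow> b_reduced r \<Longrightarrow> c_reduced (\<iota>3 # s @ r)"
| cc: "s \<in> S3_words \<Longrightarrow> s \<notin> {[], [\<iota>1]} \<Longrightarrow> c_reduced r \<Longrightarrow> c_reduced (\<iota>3 # s @ r)"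
| b1: "s \<in> S3_words \<Longrightarrow> b_reduced (\<iota>2 # s)"
| bc: "s \<in> S3_words \<Longrightarrow> c_reduced r \<Longrightarrow> b_reduced (\<iota>2 # s @ r)"
| bb: "s \<in> S3_words \<Longrightarrow> s \<notin> {[], [\<iota>4]} \<Longrightarrow> b_reduced r \<Longrightarrow> b_reduced (\<iota>2 # s @ r)"

section \<open>Existence of normal forms\<close>

definition reduced_tail :: "gen list \<Rightarrow> bool" where
  "reduced_tail r \<longleftrightarrow> r = [] \<or> c_reduced r \<or> b_reduced r"

lemma c_reduced_tail:
  "c_reduced r \<Longrightarrow> \<exists>s r'. s \<in> S3_words \<and> reduced_tail r' \<and> r = \<iota>3 # s @ r'"
proof (erule c_reduced.cases)
  fix s assume "r = \<iota>3 # s" "s \<in> S3_words"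
  then show ?thesis by (intro exI[of _ s] exI[of _ "[]"]) (simp add: reduced_tail_def)
qed (auto simp: reduced_tail_def)

lemma b_reduced_tail:
  "b_reduced r \<Longrightarrow> \<exists>s r'. s \<in> S3_words \<and> reduced_tail r' \<and> r = \<iota>2 # s @ r'"
proof (erule b_reduced.cases)
  fix s assume "r = \<iota>2 # s" "s \<in> S3_words"
  then show ?thesis by (intro exI[of _ s] exI[of _ "[]"]) (simp add: reduced_tail_def)
qed (auto simp: reduced_tail_def)

text \<open>Letters are added on the left. \<open>\<iota>1\<close> and \<open>\<iota>4\<close> are
  absorbed by the \<open>S3_words\<close> prefix; \<open>\<iota>3\<close> and
  \<open>\<iota>2\<close> open a longer tail, unless the prefix commutes with them and the old tail
  starts with the same letter.\<close>

lemma normal_form: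
  "\<exists>s r. s \<in> S3_words \<and> reduced_tail r \<and> cox_eq w (s @ r)"
proof (induction w)
  case Nil
  show ?case by (intro exI[of _ "[]"]) (simp add: S3_words_def reduced_tail_def)
next
  case (Cons x w)
  then obtain s r where s: "s \<in> S3_words" and r: "reduced_tail r" and w: "cox_eq w (s @ r)" by blast
  have xw: "cox_eq (x # w) (x # s @ r)" using w by (rule cox_eq_Cons)
  have S0: "[] \<in> S3_words" by (simp add: S3_words_def)
  \<comment> \<open>The cancelling case: \<open>x\<close> passes through the prefix, cancels the
    head of the tail, and the two \<open>S3_words\<close> that now meet are merged.\<close>
  have absorb: ?case if x: "\<And>u. cox_eq (x # y # u) (y # x # u)" and sy: "s = [] \<or> s = [y]"
      and y: "y = \<iota>1 \<or> y = \<iota>4"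
      and s': "s' \<in> S3_words" and r': "reduced_tail r'" and r_eq: "r = x # s' @ r'" for y s' r'
  proof -
    obtain s'' where s'': "s'' \<in> S3_words" "cox_eq (s @ s') s''"
      using S3_words_append[OF s s'] by blast
    have "cox_eq (x # s @ r) (s @ x # r)" using sy x by auto
    also have "cox_eq (s @ x # r) (s @ (s' @ r'))"
      unfolding r_eq by (rule cox_eq_append[OF cox_eq_refl cox_eq_square])
    also have "s @ (s' @ r') = (s @ s') @ r'" by simp
    also have "cox_eq \<dots> (s'' @ r')" by (rule cox_eq_append[OF s''(2) cox_eq_refl])
    finally show ?case using xw s''(1) r' cox_eq_trans by blast
  qed
  have tail: ?case if "reduced_tail (x # s @ r)"
    using that xw S0 by (intro exI[of _ "[]"] exI[of _ "x # s @ r"]) simp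
  show ?case
  proof (cases x)
    case \<iota>1
    then obtain s' where "s' \<in> S3_words" "cox_eq (x # s) s'" using S3_words_Cons[of x s] s by auto
    moreover from this(2) have "cox_eq ((x # s) @ r) (s' @ r)" by (rule cox_eq_append) simp
    ultimately show ?thesis using r xw cox_eq_trans by fastforce
  next
    case \<iota>4
    then obtain s' where "s' \<in> S3_words" "cox_eq (x # s) s'" using S3_words_Cons[of x s] s by auto
    moreover from this(2) have "cox_eq ((x # s) @ r) (s' @ r)" by (rule cox_eq_append) simp
    ultimately show ?thesis using r xw cox_eq_trans by fastforce
  next
    case \<iota>3
    show ?thesis
    proof (cases "c_reduced r \<and> s \<in> {[], [\<iota>1]}")
      case True
      then show ?thesis using c_reduced_tail[of r] absorb[of \<iota>1] \<iota>3 cox_eq_braids(1) by auto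
    next
      case False
      then have "c_reduced (\<iota>3 # s @ r)"
        using r s c1 cb cc unfolding reduced_tail_def by (metis append_Nil2)
      then show ?thesis using tail \<iota>3 by (simp add: reduced_tail_def)
    qed
  next
    case \<iota>2
    show ?thesis
    proof (cases "b_reduced r \<and> s \<in> {[], [\<iota>4]}")
      case True
      then show ?thesis using b_reduced_tail[of r] absorb[of \<iota>4] \<iota>2 cox_eq_braids(2) by auto
    next
      case False
      then have "b_reduced (\<iota>2 # s @ r)"
        using r s b1 bc bb unfolding reduced_tail_def by (metis append_Nil2)
      then show ?thesis using tail \<iota>2 by (simp add: reduced_tail_def)
    qed
  qed
qed

section \<open>Abstract ping-pong\<close>

locale ping_pong =
  fixes f :: "gen \<Rightarrow> 'x \<Rightarrow> 'x" and N K L :: "'x \<Rightarrow> bool"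
  assumes N: "N z \<Longrightarrow> N (f s z)"
    and involution: "N z \<Longrightarrow> f s (f s z) = z"
    and braid: "N z \<Longrightarrow> f \<iota>1 (f \<iota>4 (f \<iota>1 z)) = f \<iota>4 (f \<iota>1 (f \<iota>4 z))"
    and K1: "N z \<Longrightarrow> K (f \<iota>1 z) \<longleftrightarrow> K z"
    and L4: "N z \<Longrightarrow> L (f \<iota>4 z) \<longleftrightarrow> L z"
    and K3: "N z \<Longrightarrow> \<not> K z \<Longrightarrow> K (f \<iota>3 z)"
    and L2: "N z \<Longrightarrow> \<not> L z \<Longrightarrow> L (f \<iota>2 z)"
    and KK: "N z \<Longrightarrow> K z \<Longrightarrow> \<not> K (f \<iota>4 z)"
    and LL: "N z \<Longrightarrow> L z \<Longrightarrow> \<not> L (f \<iota>1 z)"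
    and KL: "N z \<Longrightarrow> K z \<Longrightarrow> \<not> L z"
    and KL14: "N z \<Longrightarrow> K z \<Longrightarrow> \<not> L (f \<iota>1 (f \<iota>4 z))"
begin

definition base :: "'x \<Rightarrow> bool" where
  "base z \<longleftrightarrow> N z \<and> (\<forall>s\<in>S3_words. \<not> K (foldr f s z) \<and> \<not> L (foldr f s z))"

lemma N_foldr: "N z \<Longrightarrow> N (foldr f s z)"
  by (induction s) (simp_all add: N)

lemma foldr_rev: "N z \<Longrightarrow> foldr f (rev s) (foldr f s z) = z"
  by (induction s) (simp_all add: N_foldr involution)

lemma base_iff:
  "base z \<longleftrightarrow> N z \<and> \<not> K z \<and> \<not> K (f \<iota>4 z) \<and> \<not> K (f \<iota>4 (f \<iota>1 z))
    \<and> \<not> L z \<and> \<not> L (f \<iota>1 z) \<and> \<not> L (f \<iota>1 (f \<iota>4 z))"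
proof (cases "N z")
  case True
  then have "L (f \<iota>1 (f \<iota>4 (f \<iota>1 z))) \<longleftrightarrow> L (f \<iota>1 (f \<iota>4 z))"
    by (simp add: braid N L4)
  then show ?thesis
    using True by (auto simp: base_def S3_words_def N K1 L4)
qed (simp add: base_def)

text \<open>Pairs of translates of K and L, up to the action of \<open>S3\<close>, form one orbit of
  type K-K, one of type L-L and two of type K-L. The last two correspond to the double cosets of
  \<open>\<iota>1\<close> and \<open>\<iota>4\<close> in \<open>S3\<close>, which explains the four
  disjointness assumptions of the locale.\<close>

lemma S3_disjoint:
  assumes z: "N z" and s: "s \<in> S3_words"
  shows "K z \<Longrightarrow> \<not> L (foldr f s z)" "L z \<Longrightarrow> \<not> K (foldr f s z)"
    "K z \<Longrightarrow> s \<notin> {[], [\<iota>1]} \<Longrightarrow> \<not> K (foldr f s z)"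
    "L z \<Longrightarrow> s \<notin> {[], [\<iota>4]} \<Longrightarrow> \<not> L (foldr f s z)"
proof -
  have KL_all: "\<not> L (foldr f s z)" if "N z" "K z" "s \<in> S3_words" for s z
    using that(3) KL[OF that(1,2)] KL[OF N[OF that(1), of \<iota>1]] KL14[OF that(1,2)]
      KL14[OF N[OF that(1), of \<iota>1]] K1[OF that(1)] L4[OF that(1)] L4[OF N[OF that(1), of \<iota>1]] that(2)
    by (auto simp: S3_words_def)
  show "K z \<Longrightarrow> \<not> L (foldr f s z)" by (rule KL_all[OF z _ s])
  show "L z \<Longrightarrow> \<not> K (foldr f s z)"
    \<comment> \<open>The K-L case is applied at the image point with the inverse word.\<close>
    using KL_all[OF N_foldr[OF z, of s] _ S3_words_rev[OF s]] by (auto simp: foldr_rev z)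
  show "K z \<Longrightarrow> s \<notin> {[], [\<iota>1]} \<Longrightarrow> \<not> K (foldr f s z)"
    using s KK[OF z] KK[OF N[OF z, of \<iota>1]] K1[OF z] K1[OF N[OF z, of \<iota>4]]
      K1[OF N[OF N[OF z, of \<iota>1], of \<iota>4]]
    by (auto simp: S3_words_def)
  show "L z \<Longrightarrow> s \<notin> {[], [\<iota>4]} \<Longrightarrow> \<not> L (foldr f s z)"
    using s LL[OF z] LL[OF N[OF z, of \<iota>4]] L4[OF z] L4[OF N[OF z, of \<iota>1]]
      L4[OF N[OF N[OF z, of \<iota>4], of \<iota>1]] braid[OF z]
    by (auto simp: S3_words_def)
qed

text \<open>Mutual induction along the tail: the inner tail puts the point in K or L, the
  \<open>S3\<close> word moves it off the half-space belonging to the next letter, and that letter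
  sends it inside. The innermost step uses that a base point avoids every translate.\<close>

lemma reduced_maps_base:
  assumes z: "base z"
  shows "c_reduced w \<Longrightarrow> K (foldr f w z)" "b_reduced w \<Longrightarrow> L (foldr f w z)"
proof (induction rule: c_reduced_b_reduced.inducts)
  have Nz: "N z" and S3: "\<And>s. s \<in> S3_words \<Longrightarrow> \<not> K (foldr f s z) \<and> \<not> L (foldr f s z)"
    using z by (simp_all add: base_def)
  have K3': "\<not> K (foldr f w z) \<Longrightarrow> K (foldr f (\<iota>3 # w) z)"
    and L2': "\<not> L (foldr f w z) \<Longrightarrow> L (foldr f (\<iota>2 # w) z)" for w
    by (simp_all add: K3 L2 N_foldr Nz)
  {
    case (c1 s)
    then show ?case using S3 K3' by blast
  next
    case (b1 s)
    then show ?case using S3 L2' by blast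
  next
    case (cb s r)
    then show ?case using S3_disjoint(2)[OF N_foldr[OF Nz] cb(1)] by (intro K3') simp
  next
    case (cc s r)
    then show ?case using S3_disjoint(3)[OF N_foldr[OF Nz] cc(1)] by (intro K3') simp
  next
    case (bc s r)
    then show ?case using S3_disjoint(1)[OF N_foldr[OF Nz] bc(1)] by (intro L2') simp
  next
    case (bb s r)
    then show ?case using S3_disjoint(4)[OF N_foldr[OF Nz] bb(1)] by (intro L2') simp
  }
qed

text \<open>The set \<open>base\<close> is \<open>S3\<close>-invariant, so the prefix can be undone.
  For the same reason ping-pong alone says nothing about nontrivial elements with empty
  tail.\<close>

lemma foldr_reduced_not_base:
  assumes "base z" "s \<in> S3_words" "c_reduced r \<or> b_reduced r"
  shows "\<not> base (foldr f (s @ r) z)"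
proof
  assume "base (foldr f (s @ r) z)"
  then have "\<not> K (foldr f (rev s) (foldr f (s @ r) z)) \<and> \<not> L (foldr f (rev s) (foldr f (s @ r) z))"
    using S3_words_rev[OF assms(2)] unfolding base_def by blast
  moreover have "foldr f (rev s) (foldr f (s @ r) z) = foldr f r z"
    using assms(1) by (simp add: foldr_rev N_foldr base_def)
  ultimately show False using reduced_maps_base[OF assms(1), of r] assms(3) by auto
qed

end

section \<open>A criterion for discreteness and faithfulness\<close>

abbreviation refl_matrix :: "real \<Rightarrow> real \<Rightarrow> gen \<Rightarrow> complex^4^4" where
  "refl_matrix h t s \<equiv> complex_reflection (polar_vector h t s)"

definition rep_matrix :: "real \<Rightarrow> real \<Rightarrow> gen list \<Rightarrow> complex^4^4" where
  "rep_matrix h t ss = foldr (\<lambda>s A. refl_matrix h t s ** A) ss (mat 1)"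

lemma rep_matrix_simps [simp]:
  "rep_matrix h t [] = mat 1"
  "rep_matrix h t (s # ss) = refl_matrix h t s ** rep_matrix h t ss"
  by (simp_all add: rep_matrix_def)

lemma rep_matrix_append: "rep_matrix h t (ss @ ts) = rep_matrix h t ss ** rep_matrix h t ts"
  by (induction ss) (simp_all add: matrix_mul_assoc)

lemma rep_matrix_vector: "rep_matrix h t ss *v z = foldr (\<lambda>s z. refl_matrix h t s *v z) ss z"
  by (induction ss) (simp_all add: matrix_vector_mul_assoc[symmetric])

lemma U31_simps:
  "A \<otimes>\<^bsub>U31\<^esub> B = A ** B" "\<one>\<^bsub>U31\<^esub> = mat 1"
  by (simp_all add: U31_def)

lemma rep_matrix_in_U31:
  assumes "(h, t) \<in> parameter_space"
  shows "rep_matrix h t ss \<in> carrier U31"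
proof (induction ss)
  case Nil
  show ?case by (simp add: U31_def)
next
  case (Cons s ss)
  have "refl_matrix h t s \<in> carrier U31"
    by (rule complex_reflection_in_U31[OF herm_polar_vector(1)[OF assms]])
  from monoid.m_closed[OF group.is_monoid[OF group_U31] this Cons.IH]
  show ?case by (simp add: U31_simps)
qed

lemma rep_matrix_rev:
  assumes "(h, t) \<in> parameter_space"
  shows "rep_matrix h t (rev ss) ** rep_matrix h t ss = mat 1"
proof (induction ss)
  case (Cons s ss)
  have "rep_matrix h t (rev (s # ss)) ** rep_matrix h t (s # ss) =
    rep_matrix h t (rev ss) ** (refl_matrix h t s ** refl_matrix h t s) ** rep_matrix h t ss"
    by (simp add: rep_matrix_append matrix_mul_assoc)
  then show ?case
    using Cons.IH complex_reflection_mult[OF herm_polar_vector(1)[OF assms]] by simp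
qed simp

lemma proj_class_eqD:
  assumes "proj_class A = proj_class B"
  obtains c where "A = mat c ** B"
proof -
  have "mat 1 \<in> scalars" by (auto simp: scalars_def U31_def)
  then have "A \<in> proj_class A"
    unfolding proj_class_def r_coset_def by (auto simp: U31_simps intro: bexI[of _ "mat 1"])
  then have "A \<in> proj_class B" using assms by simp
  then show ?thesis
    using that unfolding proj_class_def r_coset_def scalars_def by (auto simp: U31_simps)
qed

lemma \<rho>_pos_word:
  assumes "(h, t) \<in> parameter_space"
  shows "\<rho> h t (word_class relators (pos_word ss)) = proj_class (rep_matrix h t ss)"
proof (induction ss)
  case Nil
  have "\<rho> h t \<one>\<^bsub>G\<^esub> = \<one>\<^bsub>PU31\<^esub>"
    using hom_one[OF \<rho>_hom(1)[OF assms] _ group_PU31] group_presented_group[of relators]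
    by (simp add: G_def)
  moreover have "\<one>\<^bsub>PU31\<^esub> = proj_class (mat 1)"
    using hom_one[OF proj_class_hom group_U31 group_PU31] by (simp add: U31_simps)
  ultimately show ?case by (simp add: G_def one_presented_group)
next
  case (Cons s ss)
  have "word_class relators (pos_word (s # ss)) =
      generator relators s \<otimes>\<^bsub>G\<^esub> word_class relators (pos_word ss)"
    by (simp add: G_def generator_def)
  moreover have "generator relators s \<in> carrier G" "word_class relators (pos_word ss) \<in> carrier G"
    by (simp_all add: G_def carrier_presented_group generator_def)
  ultimately have "\<rho> h t (word_class relators (pos_word (s # ss))) =
      proj_class (refl_matrix h t s) \<otimes>\<^bsub>PU31\<^esub> proj_class (rep_matrix h t ss)"
    using hom_mult[OF \<rho>_hom(1)[OF assms]] \<rho>_hom(2)[OF assms] Cons.IH by simp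
  also have "\<dots> = proj_class (refl_matrix h t s ** rep_matrix h t ss)"
    using hom_mult[OF proj_class_hom complex_reflection_in_U31[OF herm_polar_vector(1)[OF assms, of s]]
        rep_matrix_in_U31[OF assms, of ss]]
    by (simp add: U31_simps)
  finally show ?case by simp
qed

lemma carrier_G_pos_word: "carrier G = range (\<lambda>ss. word_class relators (pos_word ss))"
  unfolding G_def carrier_presented_group
proof (intro equalityI subsetI)
  fix x assume "x \<in> range (word_class relators)"
  then obtain w where "x = word_class relators w" by blast
  also have "\<dots> = word_class relators (pos_word (map fst w))"
    using word_eq_pos_word by (simp add: word_class_eq_iff)
  finally show "x \<in> range (\<lambda>ss. word_class relators (pos_word ss))" by blast
qed blast

text \<open>As \<open>V\<close> is a punctured cone, its membership depends only on projective
  classes. Since only the trivial word returns \<open>p\<close> to \<open>V\<close>, the orbit map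
  separates elements of \<open>G\<close>, and openness of \<open>V\<close> isolates each image in
  the quotient topology.\<close>

lemma discrete_faithful_criterion:
  assumes par: "(h, t) \<in> parameter_space"
    and V: "open V" "p \<in> V" and scale: "\<And>c z. c *s z \<in> V \<longleftrightarrow> c \<noteq> 0 \<and> z \<in> V"
    and free: "\<And>ss. rep_matrix h t ss *v p \<in> V \<Longrightarrow> cox_eq ss []"
  shows "discrete_faithful_rep (\<rho> h t)"
proof -
  let ?R = "rep_matrix h t" and ?w = "\<lambda>ss. word_class relators (pos_word ss)"
  \<comment> \<open>Two words sending \<open>p\<close> into the same translate of \<open>V\<close>
    are equal in \<open>G\<close>.\<close>
  have moved: "cox_eq ss ts" if "?R (rev ts) *v (?R ss *v p) \<in> V" for ss ts
  proof -
    have "?R (rev ts @ ss) *v p \<in> V"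
      using that by (simp only: rep_matrix_append matrix_vector_mul_assoc)
    then have "cox_eq (rev ts @ ss) []" by (rule free)
    then have "cox_eq (rev ts) (rev ss)" by (rule cox_eq_swap)
    then have "cox_eq (ts @ rev ts @ ss) (ts @ rev ss @ ss)"
      by (intro cox_eq_append) simp_all
    moreover have "cox_eq (ts @ rev ss @ ss) ts"
      using cox_eq_append[OF cox_eq_refl[of ts] cox_eq_rev[of "rev ss" "[]"]] by simp
    ultimately show ?thesis
      using cox_eq_rev[of ts ss] cox_eq_sym cox_eq_trans by blast
  qed
  have rev: "?R (rev ts) *v (?R ts *v z) = z" for ts z
    by (simp add: matrix_vector_mul_assoc rep_matrix_rev[OF par])
  have inj: "inj_on (\<rho> h t) (carrier G)"
  proof (rule inj_onI)
    fix x y assume "x \<in> carrier G" "y \<in> carrier G" and eq: "\<rho> h t x = \<rho> h t y"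
    then obtain ss ts where x: "x = ?w ss" and y: "y = ?w ts" by (auto simp: carrier_G_pos_word)
    have "proj_class (?R ts) = proj_class (?R ss)"
      using eq by (simp add: x y \<rho>_pos_word[OF par])
    then obtain c where c: "?R ts = mat c ** ?R ss" by (rule proj_class_eqD)
    have "c *s (?R (rev ts) *v (?R ss *v p)) = ?R (rev ts) *v (?R ts *v p)"
      unfolding c by (simp add: matrix_vector_mul_assoc[symmetric] mat_vector_mult vector_scalar_commute)
    then have "c *s (?R (rev ts) *v (?R ss *v p)) \<in> V" using V(2) by (simp add: rev)
    then have "cox_eq ss ts" by (intro moved) (simp add: scale)
    then show "x = y" by (simp add: x y cox_eq_def word_class_eq_iff)
  qed
  have sub: "subgroup (\<rho> h t ` carrier G) PU31"
  proof -
    interpret group_hom G PU31 "\<rho> h t"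
      using \<rho>_hom(1)[OF par] group_PU31 group_presented_group
      by (simp add: group_hom_def group_hom_axioms_def G_def)
    show ?thesis by (rule img_is_subgroup)
  qed
  have top: "topspace PU31_topology = carrier PU31"
    using quotient_imp_surjective_map[OF quotient_map_PU31] by (simp add: carrier_PU31)
  have isolated: "\<exists>W. openin PU31_topology W \<and> {x} = W \<inter> \<rho> h t ` carrier G"
    if x: "x \<in> \<rho> h t ` carrier G" for x
  proof -
    obtain ts where ts: "x = proj_class (?R ts)"
      using x by (auto simp: carrier_G_pos_word \<rho>_pos_word[OF par])
    \<comment> \<open>\<open>P\<close> selects the matrices sending \<open>p\<close> into the
      \<open>ts\<close>-translate of \<open>V\<close>: an open condition, invariant under scalars,
      so it descends to an open set \<open>W\<close> that meets the image only in
      \<open>x\<close>.\<close>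
    define P where "P A \<longleftrightarrow> ?R (rev ts) *v (A *v p) \<in> V" for A
    have P_cong: "P A \<longleftrightarrow> P B" if "proj_class A = proj_class B" for A B
    proof -
      have imp: "P A \<Longrightarrow> P B" if "proj_class A = proj_class B" for A B
      proof -
        assume PA: "P A"
        from that obtain c where c: "A = mat c ** B" by (rule proj_class_eqD)
        show "P B" using PA unfolding P_def c
          by (simp add: matrix_vector_mul_assoc[symmetric] mat_vector_mult vector_scalar_commute scale)
      qed
      show ?thesis using imp that by metis
    qed
    define W where "W = proj_class ` {A \<in> carrier U31. P A}"
    have "{A \<in> carrier U31. proj_class A \<in> W} = carrier U31 \<inter> {A. P A}"
      unfolding W_def using P_cong by blast
    moreover have "open {A. P A}"
    proof -
      have "continuous_on UNIV (\<lambda>A. ?R (rev ts) *v (A *v p))"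
        unfolding matrix_vector_mult_def by (intro continuous_intros)
      from open_vimage[OF V(1) this] show ?thesis by (simp add: P_def vimage_def)
    qed
    ultimately have W: "openin PU31_topology W"
      unfolding openin_PU31_topology by (auto simp: W_def carrier_PU31 openin_open)
    have "y = x" if y: "y \<in> W" "y \<in> \<rho> h t ` carrier G" for y
    proof -
      obtain ss where ss: "y = proj_class (?R ss)"
        using y(2) by (auto simp: carrier_G_pos_word \<rho>_pos_word[OF par])
      have "P (?R ss)" using y(1) P_cong unfolding W_def ss by blast
      then have "cox_eq ss ts" unfolding P_def by (rule moved)
      then have "?w ss = ?w ts" by (simp add: cox_eq_def word_class_eq_iff)
      then show ?thesis unfolding ss ts \<rho>_pos_word[OF par, symmetric] by simp
    qed
    moreover have "x \<in> W"
      unfolding W_def ts using rep_matrix_in_U31[OF par] V(2) by (auto simp: P_def rev)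
    ultimately show ?thesis using W x by blast
  qed
  have "discrete_topology (\<rho> h t ` carrier G) = subtopology PU31_topology (\<rho> h t ` carrier G)"
    unfolding discrete_topology_unique
  proof (intro conjI ballI)
    show "topspace (subtopology PU31_topology (\<rho> h t ` carrier G)) = \<rho> h t ` carrier G"
      using subgroup.subset[OF sub] by (auto simp: top)
    show "openin (subtopology PU31_topology (\<rho> h t ` carrier G)) {x}" if "x \<in> \<rho> h t ` carrier G" for x
      using isolated[OF that] by (simp add: openin_subtopology)
  qed
  then show ?thesis
    using inj sub \<rho>_hom(1)[OF par] by (simp add: discrete_faithful_rep_def discrete_subgroup_PU31_def)
qed

section \<open>The half-spaces\<close>

declare polar_vector.simps [simp del]

definition disc :: "real \<Rightarrow> real \<Rightarrow> real" where
  "disc h t = sqrt (4 * h\<^sup>2 * cos t + 3 * h\<^sup>2 + 1)"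

text \<open>The phase \<open>cis t\<close> makes the Gram matrix of the polar vectors of \<open>\<iota>1, \<iota>2, \<iota>4\<close> real and
  independent of the parameters.\<close>

definition coord4 :: "real \<Rightarrow> real \<Rightarrow> complex^4 \<Rightarrow> complex" where
  "coord4 h t z = herm z (cis t *s polar_vector h t \<iota>4)"

lemma cis_conj_mult: "cis t * cnj (cis t) = 1"
  by (simp add: cis_cnj cis_mult)

lemma normalized_polar4:
  assumes "h \<noteq> 0"
  shows "cis t *s polar_vector h t \<iota>4 = vector [cis t + 1 / (4 * of_real h^2), - 1 / 2,
    cis t * of_real (disc h t) / (2 * of_real h), - 1 / 2]"
proof -
  have "cis t * ((a + cis (-t)) / a) = cis t + (cis t * cis (-t)) / a" if "a \<noteq> 0" for a :: complex
    using that by (simp add: field_simps)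
  from this[of "4 * of_real h^2"]
  have "cis t * ((4 * of_real h^2 + cis (-t)) / (4 * of_real h^2)) = cis t + 1 / (4 * of_real h^2)"
    using assms by (simp add: cis_mult)
  moreover have "cis t * (- cis (-t) / 2) = - 1 / 2" by (simp add: cis_mult)
  ultimately show ?thesis
    by (simp only: vec_eq_iff forall_4 vector_smult_component polar_vector.simps vector_4 disc_def)
      simp
qed

lemma coord4_eq:
  assumes "h \<noteq> 0"
  shows "coord4 h t z = z$4 * (cis (-t) + 1 / (4 * of_real h^2)) - z$2 / 2
    + z$3 * (cis (-t) * of_real (disc h t) / (2 * of_real h)) - z$1 / 2"
  using assms unfolding coord4_def normalized_polar4[OF assms]
  by (simp add: herm_eq vector_4 cis_cnj)

lemma coord4_linear:
  "coord4 h t (x + y) = coord4 h t x + coord4 h t y" "coord4 h t (- x) = - coord4 h t x" "coord4 h t (c *s x) = c * coord4 h t x"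
  by (simp_all add: coord4_def herm_linear distrib_left)

section \<open>Action of the reflections on coordinates and on the defining forms\<close>

lemma refl1:
  "(refl_matrix h t \<iota>1 *v z) $ 1 = - z$1" "(refl_matrix h t \<iota>1 *v z) $ 2 = z$2"
  "(refl_matrix h t \<iota>1 *v z) $ 4 = - z$4"
  "coord4 h t (refl_matrix h t \<iota>1 *v z) = - coord4 h t z - z$2"
proof -
  show "(refl_matrix h t \<iota>1 *v z) $ 1 = - z$1" "(refl_matrix h t \<iota>1 *v z) $ 2 = z$2"
    "(refl_matrix h t \<iota>1 *v z) $ 4 = - z$4"
    by (simp_all add: complex_reflection_apply herm_eq vector_4 polar_vector.simps)
  have "coord4 h t (polar_vector h t \<iota>1) = - 1 / 2"
    by (simp add: coord4_def herm_eq vector_4 polar_vector.simps cis_cnj cis_mult)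
  then show "coord4 h t (refl_matrix h t \<iota>1 *v z) = - coord4 h t z - z$2"
    by (simp only: complex_reflection_apply coord4_linear) (simp add: herm_eq vector_4 polar_vector.simps)
qed

lemma refl2:
  "(refl_matrix h t \<iota>2 *v z) $ 2 = z$2 - 2 * z$4" "(refl_matrix h t \<iota>2 *v z) $ 4 = - z$4"
  "coord4 h t (refl_matrix h t \<iota>2 *v z) = - coord4 h t z"
proof -
  show "(refl_matrix h t \<iota>2 *v z) $ 2 = z$2 - 2 * z$4" "(refl_matrix h t \<iota>2 *v z) $ 4 = - z$4"
    by (simp_all add: complex_reflection_apply herm_eq vector_4 polar_vector.simps)
  have "coord4 h t (polar_vector h t \<iota>2) = 0"
    by (simp add: coord4_def herm_eq vector_4 polar_vector.simps)
  then show "coord4 h t (refl_matrix h t \<iota>2 *v z) = - coord4 h t z"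
    by (simp only: complex_reflection_apply coord4_linear) simp
qed

lemma refl3:
  assumes "h \<noteq> 0"
  shows "(refl_matrix h t \<iota>3 *v z) $ 1 = z$4 / (2 * of_real h^2)"
    "(refl_matrix h t \<iota>3 *v z) $ 4 = 2 * of_real h^2 * z$1"
  using assms by (simp_all add: complex_reflection_apply herm_eq vector_4 polar_vector.simps field_simps power2_eq_square)

text \<open>A unit multiple of a polar vector defines the same reflection, so the normalized vector
  may be used.\<close>

lemma refl4:
  assumes "h \<noteq> 0"
  shows "(refl_matrix h t \<iota>4 *v z) $ 1 = - z$1 + 2 * coord4 h t z * (cis t + 1 / (4 * of_real h^2))"
    "(refl_matrix h t \<iota>4 *v z) $ 2 = - z$2 - coord4 h t z"
    "(refl_matrix h t \<iota>4 *v z) $ 4 = - z$4 - coord4 h t z"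
proof -
  have "refl_matrix h t \<iota>4 *v z = - z + (2 * coord4 h t z) *s (cis t *s polar_vector h t \<iota>4)"
    by (simp add: complex_reflection_apply coord4_def herm_linear vector_smult_assoc cis_conj_mult mult_ac)
  then show "(refl_matrix h t \<iota>4 *v z) $ 1 = - z$1 + 2 * coord4 h t z * (cis t + 1 / (4 * of_real h^2))"
    "(refl_matrix h t \<iota>4 *v z) $ 2 = - z$2 - coord4 h t z"
    "(refl_matrix h t \<iota>4 *v z) $ 4 = - z$4 - coord4 h t z"
    unfolding normalized_polar4[OF assms] by (simp_all add: vector_4)
qed

lemma coord4_refl4:
  assumes "(h, t) \<in> parameter_space"
  shows "coord4 h t (refl_matrix h t \<iota>4 *v z) = coord4 h t z"
  using herm_polar_vector(1)[OF assms, of \<iota>4]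
  by (simp add: complex_reflection_apply coord4_def herm_linear)

text \<open>\<open>QK \<ge> 0\<close> defines \<open>K\<close>, the inside of the isometric sphere of \<open>\<iota>3\<close>, and \<open>QL \<le> 0\<close> defines \<open>L\<close>. The
  second factor of \<open>QL\<close> is the product of \<open>z\<close> with the vector \<open>2 n\<^sub>1 + 2 n\<^sub>2 + cis t n\<^sub>4\<close>, the point
  orthogonal to the polar vectors \<open>n\<^sub>2\<close> and \<open>n\<^sub>4\<close>.\<close>

definition QK :: "real \<Rightarrow> complex^4 \<Rightarrow> real" where
  "QK h z = (cmod (z$4))\<^sup>2 - 4 * h^4 * (cmod (z$1))\<^sup>2"

definition QL :: "real \<Rightarrow> real \<Rightarrow> complex^4 \<Rightarrow> real" where
  "QL h t z = Re ((z$4 - z$2) * cnj (2 * z$4 + coord4 h t z))"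

lemma QK_refl1: "QK h (refl_matrix h t \<iota>1 *v z) = QK h z"
  by (simp add: QK_def refl1)

lemma QK_refl3:
  assumes "h \<noteq> 0" shows "QK h (refl_matrix h t \<iota>3 *v z) = - QK h z"
  using assms by (simp add: QK_def refl3 norm_mult norm_divide norm_power power_mult_distrib power_divide)

lemma QL_refl1: "QL h t (refl_matrix h t \<iota>1 *v z) = Re ((z$4 + z$2) * cnj (2 * z$4 + z$2 + coord4 h t z))"
  by (simp add: QL_def refl1 algebra_simps)

text \<open>The first factor of \<open>QL\<close> is the product with the polar vector of
  \<open>\<iota>2\<close>, which \<open>\<iota>2\<close> fixes; the second is a product with an
  orthogonal vector, which it negates. In contrast \<open>\<iota>4\<close> negates both
  factors.\<close>

lemma QL_refl2: "QL h t (refl_matrix h t \<iota>2 *v z) = - QL h t z"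
  by (simp add: QL_def refl2 algebra_simps)

lemma QL_refl4:
  assumes "(h, t) \<in> parameter_space"
  shows "QL h t (refl_matrix h t \<iota>4 *v z) = QL h t z"
proof -
  have "h \<noteq> 0" using assms by (auto simp: parameter_space_def)
  then show ?thesis by (simp add: QL_def refl4 coord4_refl4[OF assms] algebra_simps)
qed

lemma QL_refl14:
  assumes "(h, t) \<in> parameter_space"
  shows "QL h t (refl_matrix h t \<iota>1 *v (refl_matrix h t \<iota>4 *v z)) =
    Re ((z$4 + z$2 + 2 * coord4 h t z) * cnj (2 * z$4 + z$2 + 2 * coord4 h t z))"
proof -
  have "h \<noteq> 0" using assms by (auto simp: parameter_space_def)
  then show ?thesis by (simp add: QL_refl1 refl4 coord4_refl4[OF assms] algebra_simps)
qed

text \<open>The exact identity for the pair L, \<open>\<iota>1\<close> L. The right side is only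
  semidefinite: it vanishes on the null line spanned by the first basis vector, the fixed point of
  the parabolic \<open>\<iota>1 \<iota>2\<close>. Hence no perturbation argument could replace it;
  semidefiniteness suffices because the cone is strictly negative.\<close>

lemma QL_sum:
  assumes "(h, t) \<in> parameter_space"
  shows "Re (herm z z) + 2 * (QL h t z + QL h t (refl_matrix h t \<iota>1 *v z)) =
    (cmod (z$3 + z$4 * (of_real (disc h t) / of_real h * cis t)))\<^sup>2
      + 5 * (cmod (z$4))\<^sup>2 + 3 * (cmod (z$2))\<^sup>2"
proof -
  have h: "h \<noteq> 0" using assms by (auto simp: parameter_space_def)
  define d where "d = disc h t / h"
  have D: "d\<^sup>2 = 4 * cos t + 3 + 1 / h\<^sup>2"
    using discriminant_nonneg[OF assms] h
    by (simp add: d_def disc_def power_divide field_simps)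
  define k where "k = 1 / h\<^sup>2"
  define y where "y = coord4 h t z"
  have y: "y = z$4 * (cis (-t) + of_real (k / 4)) - z$2 / 2 + z$3 * (cis (-t) * of_real (d / 2)) - z$1 / 2"
    using h by (simp add: y_def coord4_eq d_def k_def field_simps)
  \<comment> \<open>Eliminating \<open>z$1\<close> in favour of \<open>y\<close> makes both factors
    of \<open>QL\<close> parameter-free; the parameters then enter only through the Hermitian form
    and the square on the right.\<close>
  have z1: "z$1 = - 2 * y - z$2 + 2 * z$4 * (cis (-t) + of_real (k / 4)) + z$3 * (cis (-t) * of_real d)"
    by (simp add: y algebra_simps)
  obtain a2 b2 a3 b3 a4 b4 u v where
    eqs: "z$2 = Complex a2 b2" "z$3 = Complex a3 b3" "z$4 = Complex a4 b4" "y = Complex u v"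
    by (metis complex.exhaust)
  have cs: "sin t * sin t = 1 - cos t * cos t"
    using sin_cos_squared_add[of t] by (simp add: power2_eq_square algebra_simps)
  have dd: "d * d = 4 * cos t + 3 + k" using D by (simp add: k_def power2_eq_square)
  \<comment> \<open>Variants with a trailing factor, to rewrite inside right-associated
    monomials.\<close>
  have cs': "sin t * (sin t * x) = x - cos t * (cos t * x)" "d * (d * x) = (4 * cos t + 3 + k) * x" for x
    using cs dd by (simp_all only: mult.assoc[symmetric]) (simp add: algebra_simps)
  have "of_real (disc h t) / of_real h = complex_of_real d" by (simp add: d_def)
  then show ?thesis
    unfolding QL_refl1 unfolding QL_def herm_eq y_def[symmetric] z1 eqs cmod_power2
    by (simp add: algebra_simps power2_eq_square cs cs' dd)
qed

section \<open>Positive definite combinations of the forms\<close>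

text \<open>Positivity of each form off \<open>0\<close> makes two of the half-spaces disjoint in the negative cone: on a
  negative vector in both of them every summand is nonpositive. The first form is for \<open>K, L\<close>, the second for \<open>K, \<iota>4 K\<close> and
  the third for \<open>K, \<iota>4 \<iota>1 L\<close>. The coefficients were found numerically.\<close>

definition form_KL :: "real \<Rightarrow> real \<Rightarrow> complex^4 \<Rightarrow> real" where
  "form_KL h t z = Re (herm z z) - QK h z / 4 + 8 / 5 * QL h t z"

text \<open>This is \<open>QK\<close> composed with \<open>\<iota>4\<close>, with the overall signs
  inside the moduli dropped.\<close>

definition QK4 :: "real \<Rightarrow> real \<Rightarrow> complex^4 \<Rightarrow> real" where
  "QK4 h t z = (cmod (z$4 + coord4 h t z))\<^sup>2
    - 4 * h^4 * (cmod (z$1 - 2 * coord4 h t z * (cis t + 1 / (4 * of_real h^2))))\<^sup>2"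

lemma QK_refl4:
  assumes "h \<noteq> 0" shows "QK h (refl_matrix h t \<iota>4 *v z) = QK4 h t z"
proof -
  have "cmod (- a - b) = cmod (a + b)" "cmod (- a + b) = cmod (a - b)"
    for a b :: complex
    using norm_minus_cancel[of "a + b"] norm_minus_commute[of b a] by (simp_all add: algebra_simps)
  then show ?thesis by (simp only: QK_def QK4_def refl4[OF assms])
qed

definition form_KK :: "real \<Rightarrow> real \<Rightarrow> complex^4 \<Rightarrow> real" where
  "form_KK h t z = Re (herm z z) - (QK h z + QK4 h t z) / 8"

definition form_KL14 :: "real \<Rightarrow> real \<Rightarrow> complex^4 \<Rightarrow> real" where
  "form_KL14 h t z = Re (herm z z) - QK h z
    + 4 * Re ((z$4 + z$2 + 2 * coord4 h t z) * cnj (2 * z$4 + z$2 + 2 * coord4 h t z))"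

lemma forms_scale:
  "Re (herm (c *s z) (c *s z)) = (cmod c)\<^sup>2 * Re (herm z z)"
  "QK h (c *s z) = (cmod c)\<^sup>2 * QK h z"
  "QL h t (c *s z) = (cmod c)\<^sup>2 * QL h t z"
  "form_KL h t (c *s z) = (cmod c)\<^sup>2 * form_KL h t z"
  "form_KK h t (c *s z) = (cmod c)\<^sup>2 * form_KK h t z"
  "form_KL14 h t (c *s z) = (cmod c)\<^sup>2 * form_KL14 h t z"
proof -
  have Re_cc: "Re (c * x * cnj (c * y)) = (cmod c)\<^sup>2 * Re (x * cnj y)" for x y
  proof -
    have "c * x * cnj (c * y) = (c * cnj c) * (x * cnj y)" by (simp add: mult_ac)
    also have "\<dots> = of_real ((cmod c)\<^sup>2) * (x * cnj y)" by (simp only: complex_norm_square)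
    finally show ?thesis by (simp only: Re_complex_of_real Im_complex_of_real times_complex.sel mult_zero_left diff_zero)
  qed
  show 1: "Re (herm (c *s z) (c *s z)) = (cmod c)\<^sup>2 * Re (herm z z)"
    unfolding herm_eq vector_smult_component plus_complex.sel Re_cc by (simp add: distrib_left)
  show 2: "QK h (c *s z) = (cmod c)\<^sup>2 * QK h z" for z
    by (simp add: QK_def norm_mult power_mult_distrib algebra_simps)
  have "QL h t (c *s z) = Re (c * (z$4 - z$2) * cnj (c * (2 * z$4 + coord4 h t z)))"
    by (simp only: QL_def coord4_linear vector_smult_component) (simp add: algebra_simps)
  then show 3: "QL h t (c *s z) = (cmod c)\<^sup>2 * QL h t z"
    by (simp only: Re_cc QL_def)
  have 4: "QK4 h t (c *s z) = (cmod c)\<^sup>2 * QK4 h t z"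
  proof -
    have "c * z$4 + c * y = c * (z$4 + y)" "c * z$1 - 2 * (c * y) * w = c * (z$1 - 2 * y * w)" for y w
      by (simp_all add: algebra_simps)
    then show ?thesis
      by (simp only: QK4_def coord4_linear vector_smult_component norm_mult power_mult_distrib)
        (simp add: algebra_simps)
  qed
  show "form_KL h t (c *s z) = (cmod c)\<^sup>2 * form_KL h t z"
    unfolding form_KL_def 1 2 3 by (simp add: algebra_simps)
  show "form_KK h t (c *s z) = (cmod c)\<^sup>2 * form_KK h t z"
    unfolding form_KK_def 1 2 4 by (simp add: algebra_simps)
  have "Re (((c *s z)$4 + (c *s z)$2 + 2 * coord4 h t (c *s z)) *
      cnj (2 * (c *s z)$4 + (c *s z)$2 + 2 * coord4 h t (c *s z))) =
    Re (c * (z$4 + z$2 + 2 * coord4 h t z) * cnj (c * (2 * z$4 + z$2 + 2 * coord4 h t z)))"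
    by (simp only: coord4_linear vector_smult_component) (simp add: algebra_simps)
  then show "form_KL14 h t (c *s z) = (cmod c)\<^sup>2 * form_KL14 h t z"
    unfolding form_KL14_def 1 2 by (simp only: Re_cc) (simp add: algebra_simps)
qed

text \<open>Homogeneity reduces positivity to the unit sphere, where compactness and the tube lemma
  give one neighborhood of \<open>x0\<close> for all directions.\<close>

lemma eventually_pos_homogeneous:
  fixes F :: "'a::topological_space \<Rightarrow> complex^4 \<Rightarrow> real"
  assumes S: "open S" "x0 \<in> S" and cont: "continuous_on (S \<times> UNIV) (\<lambda>y. F (fst y) (snd y))"
    and hom: "\<And>x c z. F x (c *s z) = (cmod c)\<^sup>2 * F x z"
    and pos: "\<And>z. z \<noteq> 0 \<Longrightarrow> 0 < F x0 z"
  shows "\<forall>\<^sub>F x in nhds x0. \<forall>z. z \<noteq> 0 \<longrightarrow> 0 < F x z"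
proof -
  define W where "W = (S \<times> UNIV) \<inter> (\<lambda>y. F (fst y) (snd y)) -` {0<..}"
  have W: "open W"
    unfolding W_def using S by (intro continuous_open_preimage[OF cont] open_Times) auto
  have sub: "{x0} \<times> (sphere 0 1 :: (complex^4) set) \<subseteq> W"
  proof
    fix y assume "y \<in> {x0} \<times> (sphere 0 1 :: (complex^4) set)"
    then have "fst y = x0" "snd y \<noteq> 0" by auto
    then show "y \<in> W" using S pos by (cases y) (simp add: W_def)
  qed
  from Elementary_Topology.tube_lemma[OF compact_sphere W sub]
  obtain X where X: "x0 \<in> X" "open X" "X \<times> (sphere 0 1 :: (complex^4) set) \<subseteq> W" by blast
  have "0 < F x z" if "x \<in> X" "z \<noteq> 0" for x z
  proof -
    define w where "w = inverse (norm z) *\<^sub>R z"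
    have "w \<in> sphere 0 1" using that(2) by (simp add: w_def)
    then have "(x, w) \<in> W" using X(3) that(1) by blast
    then have "0 < F x w" by (simp add: W_def)
    moreover have z: "of_real (norm z) *s w = z"
    proof -
      have "of_real (norm z) * (inverse (norm z) *\<^sub>R (z $ i)) = z $ i" for i
        using that(2) by (simp add: scaleR_conv_of_real[of _ "z $ i"])
      then show ?thesis
        by (simp only: vec_eq_iff w_def vector_smult_component vector_scaleR_component) simp
    qed
    have "F x z = (norm z)\<^sup>2 * F x w"
      using hom[of x "of_real (norm z)" w] unfolding z by simp
    ultimately show ?thesis using that(2) by simp
  qed
  then show ?thesis using X(1,2) unfolding eventually_nhds by blast
qed

abbreviation (input) params :: "(real \<times> real) set" where "params \<equiv> {0<..} \<times> UNIV"

lemma continuous_on_coord4: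
  fixes A :: "'a::t2_space set"
  assumes "continuous_on A h" "continuous_on A t" "continuous_on A z" "\<And>x. x \<in> A \<Longrightarrow> 0 < h x"
  shows "continuous_on A (\<lambda>x. coord4 (h x) (t x) (z x))"
proof -
  have h: "h x \<noteq> 0" if "x \<in> A" for x using assms(4)[OF that] by simp
  have "continuous_on A (\<lambda>x. z x $4 * (cis (- t x) + 1 / (4 * of_real (h x)^2)) - z x$2 / 2
    + z x$3 * (cis (- t x) * of_real (disc (h x) (t x)) / (2 * of_real (h x))) - z x$1 / 2)"
    unfolding disc_def by (intro continuous_intros assms(1,2,3)) (simp_all add: h)
  then show ?thesis
    by (rule continuous_on_eq) (simp add: coord4_eq h)
qed

lemma continuous_on_QK:
  assumes "continuous_on A h" "continuous_on A z"
  shows "continuous_on A (\<lambda>x. QK (h x) (z x))"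
  unfolding QK_def by (intro continuous_intros assms)

lemma continuous_on_QK4:
  fixes A :: "'a::t2_space set"
  assumes "continuous_on A h" "continuous_on A t" "continuous_on A z" "\<And>x. x \<in> A \<Longrightarrow> 0 < h x"
  shows "continuous_on A (\<lambda>x. QK4 (h x) (t x) (z x))"
proof -
  have "h x \<noteq> 0" if "x \<in> A" for x using assms(4)[OF that] by simp
  then show ?thesis
    unfolding QK4_def by (intro continuous_intros continuous_on_coord4 assms) simp_all
qed

lemma continuous_on_QL:
  fixes A :: "'a::t2_space set"
  assumes "continuous_on A h" "continuous_on A t" "continuous_on A z" "\<And>x. x \<in> A \<Longrightarrow> 0 < h x"
  shows "continuous_on A (\<lambda>x. QL (h x) (t x) (z x))"
  unfolding QL_def by (intro continuous_intros continuous_on_coord4 assms)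

text \<open>The linear forms inside the moduli are unitriangular in \<open>z$1\<close>,
  \<open>z$2\<close>, \<open>z$4\<close>, so they and \<open>z$3\<close> vanish together only at the
  origin.\<close>

lemma triangular_form_pos:
  fixes z :: "complex^4" and a b c :: real
  assumes "z \<noteq> 0" "0 < a" "0 < b" "0 < c"
  shows "0 < a * (cmod (z$1 + \<alpha> * z$2 + \<beta> * z$4))\<^sup>2 + b * (cmod (z$2 + \<gamma> * z$4))\<^sup>2
    + c * (cmod (z$4))\<^sup>2 + (cmod (z$3))\<^sup>2" (is "0 < ?P + ?Q + ?R + ?S")
proof (rule ccontr)
  assume "\<not> 0 < ?P + ?Q + ?R + ?S"
  moreover have nn: "0 \<le> ?P" "0 \<le> ?Q" "0 \<le> ?R" "0 \<le> ?S" using assms by simp_all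
  ultimately have "?P = 0" "?Q = 0" "?R = 0" "?S = 0" by linarith+
  then have "z$1 = 0" "z$2 = 0" "z$3 = 0" "z$4 = 0" using assms(2-4) by auto
  then show False using assms(1) by (simp add: vec_eq_iff forall_4)
qed

section \<open>Evaluation at the central parameter\<close>

abbreviation (input) center :: "real \<times> real" where "center \<equiv> (sqrt 2, arccos (- 7 / 8))"

text \<open>Since \<open>disc\<close> vanishes here, \<open>z$3\<close> drops out of
  \<open>coord4\<close> and enters the forms only through its squared modulus.\<close>

lemma center_simps:
  "disc (sqrt 2) (arccos (- 7 / 8)) = 0"
  "cis (arccos (- 7 / 8)) = Complex (- 7 / 8) (sqrt 15 / 8)"
  "coord4 (sqrt 2) (arccos (- 7 / 8)) z =
    z$4 * Complex (- 3 / 4) (- sqrt 15 / 8) - z$2 / 2 - z$1 / 2"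
proof -
  have c: "cos (arccos (- 7 / 8)) = - 7 / 8" by (rule cos_arccos) simp_all
  then have d: "disc (sqrt 2) (arccos (- (7 / 8))) = 0" by (simp add: disc_def)
  then show "disc (sqrt 2) (arccos (- 7 / 8)) = 0" by simp
  have "sin (arccos (- 7 / 8)) = sqrt (15 / 64)"
    by (subst sin_arccos) (simp_all add: power2_eq_square)
  then have s: "sin (arccos (- 7 / 8)) = sqrt 15 / 8"
    by (simp add: real_sqrt_divide)
  show "cis (arccos (- 7 / 8)) = Complex (- 7 / 8) (sqrt 15 / 8)"
    using c s by (simp add: cis.ctr)
  have "cis (- arccos (- 7 / 8)) + 1 / 8 = Complex (- 3 / 4) (- sqrt 15 / 8)"
    using c s by (simp add: complex_eq_iff)
  moreover have "complex_of_real (sqrt 2)^2 = 2"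
    by (simp flip: of_real_power)
  ultimately show "coord4 (sqrt 2) (arccos (- 7 / 8)) z =
      z$4 * Complex (- 3 / 4) (- sqrt 15 / 8) - z$2 / 2 - z$1 / 2"
    using d by (simp add: coord4_eq)
qed

lemma sqrt15: "sqrt 15 * sqrt 15 = 15" "sqrt 15 * (sqrt 15 * x) = 15 * x"
  by (simp_all add: mult.assoc[symmetric])

lemma QK4_center:
  "QK4 (sqrt 2) (arccos (- 7 / 8)) z =
    (cmod (Complex (1/4) (- sqrt 15 / 8) * z$4 - z$2 / 2 - z$1 / 2))\<^sup>2
    - 16 * (cmod (Complex (1/4) (sqrt 15 / 8) * z$1 + Complex (- 3/4) (sqrt 15 / 8) * z$2 - 51/32 * z$4))\<^sup>2"
proof -
  have h: "sqrt 2 ^ 4 = 4" "complex_of_real (sqrt 2)^2 = 2"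
    by (simp_all flip: of_real_power) (simp add: power4_eq_xxxx)
  have 1: "z$4 + (z$4 * Complex (- 3 / 4) (- sqrt 15 / 8) - z$2 / 2 - z$1 / 2) =
    Complex (1/4) (- sqrt 15 / 8) * z$4 - z$2 / 2 - z$1 / 2"
    by (simp add: complex_eq_iff algebra_simps)
  \<comment> \<open>The coefficient 51/32 is twice the squared modulus 51/64 of
    \<open>Complex (- 3/4) (sqrt 15 / 8)\<close>.\<close>
  have 2: "z$1 - 2 * (z$4 * Complex (- 3 / 4) (- sqrt 15 / 8) - z$2 / 2 - z$1 / 2) *
      (Complex (- 7 / 8) (sqrt 15 / 8) + 1 / (4 * 2)) =
    Complex (1/4) (sqrt 15 / 8) * z$1 + Complex (- 3/4) (sqrt 15 / 8) * z$2 - 51/32 * z$4"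
    by (simp add: complex_eq_iff algebra_simps sqrt15 add_divide_distrib diff_divide_distrib)
  show ?thesis unfolding QK4_def center_simps h 1 2 by simp
qed

text \<open>The sums of squares are the \<open>LDL\<close> decompositions over \<open>\<rat>(\<surd>-15)\<close>.\<close>

lemma forms_center_pos:
  assumes "z \<noteq> 0"
  shows "0 < form_KL (sqrt 2) (arccos (- 7 / 8)) z" "0 < form_KK (sqrt 2) (arccos (- 7 / 8)) z"
    "0 < form_KL14 (sqrt 2) (arccos (- 7 / 8)) z"
proof -
  obtain a1 b1 a2 b2 a3 b3 a4 b4 where
    z: "z$1 = Complex a1 b1" "z$2 = Complex a2 b2" "z$3 = Complex a3 b3" "z$4 = Complex a4 b4"
    by (metis complex.exhaust)
  have h: "sqrt 2 ^ 4 = 4" by (simp add: power4_eq_xxxx)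
  note expand = algebra_simps power2_eq_square sqrt15 add_divide_distrib diff_divide_distrib
  let ?z = "\<lambda>x y. Complex x (y * sqrt 15)"
  have form_KL: "form_KL (sqrt 2) (arccos (- 7 / 8)) z =
      4 * (cmod (z$1 + ?z (1/10) 0 * z$2 + ?z (3/20) 0 * z$4))\<^sup>2
      + 44/25 * (cmod (z$2 + ?z (-73/88) (5/88) * z$4))\<^sup>2 + 4/11 * (cmod (z$4))\<^sup>2 + (cmod (z$3))\<^sup>2"
    unfolding form_KL_def QK_def QL_def herm_eq center_simps h cmod_power2 z
    by (simp add: expand)
  show "0 < form_KL (sqrt 2) (arccos (- 7 / 8)) z"
    unfolding form_KL by (rule triangular_form_pos[OF assms]) simp_all
  \<comment> \<open>The zero coefficients and the factor 1 keep the shape of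
    \<open>triangular_form_pos\<close>.\<close>
  have form_KL14: "form_KL14 (sqrt 2) (arccos (- 7 / 8)) z =
      20 * (cmod (z$1 + ?z 0 0 * z$2 + ?z (1/20) (1/20) * z$4))\<^sup>2
      + 1 * (cmod (z$2 + ?z 0 0 * z$4))\<^sup>2 + 19/20 * (cmod (z$4))\<^sup>2 + (cmod (z$3))\<^sup>2"
    unfolding form_KL14_def QK_def herm_eq center_simps h cmod_power2 z
    by (simp add: expand)
  show "0 < form_KL14 (sqrt 2) (arccos (- 7 / 8)) z"
    unfolding form_KL14 by (rule triangular_form_pos[OF assms]) simp_all
  have form_KK: "form_KK (sqrt 2) (arccos (- 7 / 8)) z =
      41/16 * (cmod (z$1 + ?z (1/41) (4/41) * z$2 + ?z (7/82) (25/164) * z$4))\<^sup>2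
      + 90/41 * (cmod (z$2 + ?z (5/6) (11/60) * z$4))\<^sup>2 + 11/8 * (cmod (z$4))\<^sup>2 + (cmod (z$3))\<^sup>2"
    unfolding form_KK_def QK_def QK4_center herm_eq h cmod_power2 z
    by (simp add: expand)
  show "0 < form_KK (sqrt 2) (arccos (- 7 / 8)) z"
    unfolding form_KK by (rule triangular_form_pos[OF assms]) simp_all
qed

section \<open>The open set that nontrivial elements move off itself\<close>

abbreviation I1 :: "complex^4 \<Rightarrow> complex^4" where
  "I1 z \<equiv> complex_reflection (vector [0, 1, 0, 0]) *v z"

text \<open>The three moduli in the last line are permuted faithfully by \<open>S\<^sub>3\<close>.\<close>

definition chamber :: "real \<Rightarrow> real \<Rightarrow> complex^4 \<Rightarrow> bool" where
  "chamber h t z \<longleftrightarrow> Re (herm z z) < 0 \<and> QK h z < 0 \<and> QK4 h t z < 0 \<and> QK4 h t (I1 z) < 0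
    \<and> 0 < QL h t z \<and> 0 < QL h t (I1 z)
    \<and> 0 < Re ((z$4 + z$2 + 2 * coord4 h t z) * cnj (2 * z$4 + z$2 + 2 * coord4 h t z))
    \<and> cmod (z$2) < cmod (coord4 h t z) \<and> cmod (coord4 h t z) < cmod (z$2 + coord4 h t z)"

lemma open_Collect_less_on:
  fixes f g :: "'a::topological_space \<Rightarrow> real"
  assumes "open A" "continuous_on A f" "continuous_on A g"
  shows "open {x \<in> A. f x < g x}"
proof -
  have "open (A \<inter> (\<lambda>x. g x - f x) -` {0<..})"
    using assms by (intro continuous_open_preimage continuous_intros) auto
  moreover have "A \<inter> (\<lambda>x. g x - f x) -` {0<..} = {x \<in> A. f x < g x}" by auto
  ultimately show ?thesis by simp
qed

text \<open>Parameters and point vary together, since openness is needed both in the point, for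
  discreteness, and in the parameters, for the neighborhood.\<close>

lemma open_chamber:
  fixes A :: "'a::t2_space set"
  assumes A: "open A" and h: "continuous_on A h" and t: "continuous_on A t" and z: "continuous_on A z"
    and pos: "\<And>x. x \<in> A \<Longrightarrow> 0 < h x"
  shows "open {x \<in> A. chamber (h x) (t x) (z x)}"
proof -
  have 1: "continuous_on A (\<lambda>x. I1 (z x))"
    unfolding complex_reflection_apply herm_eq vector_scalar_mult_def
    by (intro continuous_intros z)
  have "open ({x \<in> A. Re (herm (z x) (z x)) < 0} \<inter> {x \<in> A. QK (h x) (z x) < 0}
    \<inter> {x \<in> A. QK4 (h x) (t x) (z x) < 0} \<inter> {x \<in> A. QK4 (h x) (t x) (I1 (z x)) < 0}
    \<inter> {x \<in> A. 0 < QL (h x) (t x) (z x)} \<inter> {x \<in> A. 0 < QL (h x) (t x) (I1 (z x))}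
    \<inter> {x \<in> A. 0 < Re ((z x$4 + z x$2 + 2 * coord4 (h x) (t x) (z x))
        * cnj (2 * z x$4 + z x$2 + 2 * coord4 (h x) (t x) (z x)))}
    \<inter> {x \<in> A. cmod (z x$2) < cmod (coord4 (h x) (t x) (z x))}
    \<inter> {x \<in> A. cmod (coord4 (h x) (t x) (z x)) < cmod (z x$2 + coord4 (h x) (t x) (z x))})"
    unfolding herm_eq
    by (intro open_Int open_Collect_less_on A continuous_intros continuous_on_coord4 continuous_on_QK
        continuous_on_QK4 continuous_on_QL h t z 1 pos)
  then show ?thesis
    by (rule back_subst[of "open"]) (auto simp: chamber_def)
qed

lemma chamber_scale: "chamber h t (c *s z) \<longleftrightarrow> c \<noteq> 0 \<and> chamber h t z"
proof (cases "c = 0")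
  case True
  then show ?thesis by (simp add: chamber_def forms_scale)
next
  case False
  have pos: "(cmod c)\<^sup>2 * x < 0 \<longleftrightarrow> x < 0" "0 < (cmod c)\<^sup>2 * x \<longleftrightarrow> 0 < x" for x
    using False by (simp_all add: mult_less_0_iff zero_less_mult_iff)
  have "Re (((c *s z)$4 + (c *s z)$2 + 2 * coord4 h t (c *s z))
      * cnj (2 * (c *s z)$4 + (c *s z)$2 + 2 * coord4 h t (c *s z)))
    = (cmod c)\<^sup>2 * Re ((z$4 + z$2 + 2 * coord4 h t z) * cnj (2 * z$4 + z$2 + 2 * coord4 h t z))"
    using forms_scale(6)[of h t c z] unfolding form_KL14_def forms_scale by (simp add: algebra_simps)
  moreover have "QK4 h t (c *s z) = (cmod c)\<^sup>2 * QK4 h t z" for z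
    using forms_scale(5)[of h t c z] unfolding form_KK_def forms_scale by (simp add: algebra_simps)
  moreover have "cmod ((c *s z)$2) = cmod c * cmod (z$2)" "cmod (coord4 h t (c *s z)) = cmod c * cmod (coord4 h t z)"
    "cmod ((c *s z)$2 + coord4 h t (c *s z)) = cmod c * cmod (z$2 + coord4 h t z)"
    by (simp_all only: vector_smult_component coord4_linear norm_mult distrib_left[symmetric])
  ultimately show ?thesis
    using False unfolding chamber_def by (simp only: vector_scalar_commute forms_scale pos) simp
qed

text \<open>The first entry solves \<open>coord4\<close> = 2 at the center for second entry 1 and
  fourth entry 11, so the three moduli compared in \<open>chamber\<close> are 1, 2 and 3.\<close>

definition base_point :: "complex^4" where
  "base_point = vector [Complex (- 43 / 2) (- 11 * sqrt 15 / 4), 1, 0, 11]"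

lemma chamber_base_point: "chamber (sqrt 2) (arccos (- 7 / 8)) base_point"
proof -
  have c: "base_point$1 = Complex (- 43 / 2) (- 11 * sqrt 15 / 4)" "base_point$2 = 1"
    "base_point$3 = 0" "base_point$4 = 11" by (simp_all add: base_point_def vector_4)
  have I1: "I1 z $ 1 = - z$1" "I1 z $ 2 = z$2" "I1 z $ 4 = - z$4" for z
    by (simp_all add: complex_reflection_apply herm_eq vector_4)
  have coord4: "coord4 (sqrt 2) (arccos (- 7 / 8)) base_point = 2"
    unfolding center_simps c by (simp add: complex_eq_iff)
  have Y1: "coord4 (sqrt 2) (arccos (- 7 / 8)) (I1 base_point) = - 3"
    unfolding center_simps c I1 by (simp add: complex_eq_iff)
  have h: "sqrt 2 ^ 4 = 4" "complex_of_real (sqrt 2)^2 = 2"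
    by (simp_all flip: of_real_power) (simp add: power4_eq_xxxx)
  have k: "Complex (- 7 / 8) (sqrt 15 / 8) + 1 / (4 * 2) = Complex (- 3 / 4) (sqrt 15 / 8)"
    by (simp add: complex_eq_iff)
  show ?thesis
    unfolding chamber_def QK_def QK4_def QL_def herm_eq coord4 Y1 I1 c h center_simps(2) k
    by (simp add: cmod_power2) (simp add: power2_eq_square algebra_simps sqrt15)
qed

definition certified :: "real \<Rightarrow> real \<Rightarrow> bool" where
  "certified h t \<longleftrightarrow> (\<forall>z. z \<noteq> 0 \<longrightarrow> 0 < form_KL h t z \<and> 0 < form_KK h t z \<and> 0 < form_KL14 h t z)"

lemma eventually_certified:
  "\<forall>\<^sub>F x in nhds center. certified (fst x) (snd x) \<and> chamber (fst x) (snd x) base_point"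
proof -
  have S: "open params" "center \<in> params" by (auto intro: open_Times)
  have c: "continuous_on (params \<times> UNIV) (\<lambda>y. form_KL (fst (fst y)) (snd (fst y)) (snd y :: complex^4))"
    "continuous_on (params \<times> UNIV) (\<lambda>y. form_KK (fst (fst y)) (snd (fst y)) (snd y :: complex^4))"
    "continuous_on (params \<times> UNIV) (\<lambda>y. form_KL14 (fst (fst y)) (snd (fst y)) (snd y :: complex^4))"
    unfolding form_KL_def form_KK_def form_KL14_def herm_eq
    by (intro continuous_intros continuous_on_coord4 continuous_on_QK continuous_on_QK4 continuous_on_QL; force)+
  have "\<forall>\<^sub>F x in nhds center. \<forall>z. z \<noteq> 0 \<longrightarrow> 0 < form_KL (fst x) (snd x) z"
    by (rule eventually_pos_homogeneous[OF S c(1) forms_scale(4)]) (simp only: fst_conv snd_conv, rule forms_center_pos)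
  moreover have "\<forall>\<^sub>F x in nhds center. \<forall>z. z \<noteq> 0 \<longrightarrow> 0 < form_KK (fst x) (snd x) z"
    by (rule eventually_pos_homogeneous[OF S c(2) forms_scale(5)]) (simp only: fst_conv snd_conv, rule forms_center_pos)
  moreover have "\<forall>\<^sub>F x in nhds center. \<forall>z. z \<noteq> 0 \<longrightarrow> 0 < form_KL14 (fst x) (snd x) z"
    by (rule eventually_pos_homogeneous[OF S c(3) forms_scale(6)]) (simp only: fst_conv snd_conv, rule forms_center_pos)
  moreover have "\<forall>\<^sub>F x in nhds center. chamber (fst x) (snd x) base_point"
  proof -
    have "open {x \<in> params. chamber (fst x) (snd x) base_point}"
      by (rule open_chamber) (auto intro!: S continuous_intros)
    then show ?thesis
      unfolding eventually_nhds using S(2) chamber_base_point by fastforce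
  qed
  ultimately show ?thesis
    by eventually_elim (simp add: certified_def)
qed

section \<open>Verification of ping-pong and conclusion\<close>

lemma herm_refl_matrix:
  assumes "(h, t) \<in> parameter_space"
  shows "herm (refl_matrix h t s *v z) (refl_matrix h t s *v w) = herm z w"
  using complex_reflection_in_U31[OF herm_polar_vector(1)[OF assms]] by (simp add: U31_def)

lemma ping_pong_refl_matrix:
  assumes par: "(h, t) \<in> parameter_space" and cert: "certified h t"
  shows "ping_pong (\<lambda>s z. refl_matrix h t s *v z) (\<lambda>z. Re (herm z z) < 0)
    (\<lambda>z. 0 \<le> QK h z) (\<lambda>z. QL h t z \<le> 0)"
proof
  have h: "h \<noteq> 0" using par by (auto simp: parameter_space_def)
  note n = herm_polar_vector[OF par]
  have F: "0 < form_KL h t z" "0 < form_KK h t z" "0 < form_KL14 h t z" if "Re (herm z z) < 0" for z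
  proof -
    have "z \<noteq> 0" using that by (auto simp: herm_eq)
    then show "0 < form_KL h t z" "0 < form_KK h t z" "0 < form_KL14 h t z" using cert by (auto simp: certified_def)
  qed
  fix z :: "complex^4" and s assume N: "Re (herm z z) < 0"
  show "Re (herm (refl_matrix h t s *v z) (refl_matrix h t s *v z)) < 0"
    using N by (simp add: herm_refl_matrix[OF par])
  have inv: "refl_matrix h t s *v (refl_matrix h t s *v z) = z" for s z
    using complex_reflection_mult[OF n(1)] by (simp add: matrix_vector_mul_assoc)
  then show "refl_matrix h t s *v (refl_matrix h t s *v z) = z" .
  define A B where "A = (\<lambda>z. refl_matrix h t \<iota>1 *v z)" and "B = (\<lambda>z. refl_matrix h t \<iota>4 *v z)"
  have "A (B (A (B (A (B z))))) = z" for z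
    using complex_reflection_braid[OF n(1) n(1) n(4)]
    by (simp add: A_def B_def matrix_vector_mul_assoc matrix_mul_assoc)
  \<comment> \<open>The order-three relation is used at \<open>B (A (B z))\<close>; cancelling the
    involutions in the middle gives the braid relation.\<close>
  then have "A (B (A (B (A (B (B (A (B z)))))))) = B (A (B z))" .
  then show "refl_matrix h t \<iota>1 *v (refl_matrix h t \<iota>4 *v (refl_matrix h t \<iota>1 *v z)) =
      refl_matrix h t \<iota>4 *v (refl_matrix h t \<iota>1 *v (refl_matrix h t \<iota>4 *v z))"
    by (simp add: A_def B_def inv)
  show "0 \<le> QK h (refl_matrix h t \<iota>1 *v z) \<longleftrightarrow> 0 \<le> QK h z" by (simp add: QK_refl1)
  show "QL h t (refl_matrix h t \<iota>4 *v z) \<le> 0 \<longleftrightarrow> QL h t z \<le> 0" by (simp add: QL_refl4[OF par])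
  show "\<not> 0 \<le> QK h z \<Longrightarrow> 0 \<le> QK h (refl_matrix h t \<iota>3 *v z)" by (simp add: QK_refl3[OF h])
  show "\<not> QL h t z \<le> 0 \<Longrightarrow> QL h t (refl_matrix h t \<iota>2 *v z) \<le> 0" by (simp add: QL_refl2)
  show "0 \<le> QK h z \<Longrightarrow> \<not> 0 \<le> QK h (refl_matrix h t \<iota>4 *v z)"
    using F(2)[OF N] N unfolding form_KK_def QK_refl4[OF h] by (auto simp: field_simps)
  show "\<not> QL h t (refl_matrix h t \<iota>1 *v z) \<le> 0" if "QL h t z \<le> 0"
  proof -
    have "0 \<le> Re (herm z z) + 2 * (QL h t z + QL h t (refl_matrix h t \<iota>1 *v z))"
      unfolding QL_sum[OF par] by simp
    then show ?thesis using N that by (auto simp: algebra_simps)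
  qed
  show "0 \<le> QK h z \<Longrightarrow> \<not> QL h t z \<le> 0"
    using F(1)[OF N] N unfolding form_KL_def by (intro notI) linarith
  show "0 \<le> QK h z \<Longrightarrow> \<not> QL h t (refl_matrix h t \<iota>1 *v (refl_matrix h t \<iota>4 *v z)) \<le> 0"
    using F(3)[OF N] N unfolding form_KL14_def QL_refl14[OF par] by (intro notI) linarith
qed

lemma discrete_faithful_if_certified:
  assumes par: "(h, t) \<in> parameter_space" and cert: "certified h t" and p: "chamber h t p"
  shows "discrete_faithful_rep (\<rho> h t)"
proof (rule discrete_faithful_criterion[OF par, where V = "{z. chamber h t z}" and p = p])
  have h: "0 < h" using par by (auto simp: parameter_space_def)
  interpret ping_pong "\<lambda>s z. refl_matrix h t s *v z" "\<lambda>z. Re (herm z z) < 0"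
    "\<lambda>z. 0 \<le> QK h z" "\<lambda>z. QL h t z \<le> 0"
    by (rule ping_pong_refl_matrix[OF par cert])
  have base: "base z" if "chamber h t z" for z
    using that h unfolding base_iff QL_refl14[OF par]
    by (auto simp: chamber_def QK_refl4 polar_vector.simps(1))
  show "open {z. chamber h t z}"
    using open_chamber[of UNIV "\<lambda>_. h" "\<lambda>_. t" "\<lambda>z. z"] h by simp
  show "p \<in> {z. chamber h t z}" using p by simp
  show "c *s z \<in> {z. chamber h t z} \<longleftrightarrow> c \<noteq> 0 \<and> z \<in> {z. chamber h t z}" for c z
    by (simp add: chamber_scale)
  fix ss assume "rep_matrix h t ss *v p \<in> {z. chamber h t z}"
  then have ss: "chamber h t (rep_matrix h t ss *v p)" by simp
  obtain s r where s: "s \<in> S3_words" and r: "reduced_tail r" and eq: "cox_eq ss (s @ r)"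
    using normal_form by blast
  have "proj_class (rep_matrix h t ss) = proj_class (rep_matrix h t (s @ r))"
    using eq unfolding \<rho>_pos_word[OF par, symmetric] cox_eq_def word_class_eq_iff[symmetric] by simp
  \<comment> \<open>Equality of words controls the matrices only up to a scalar, which is enough for
    a cone.\<close>
  then obtain c where c: "rep_matrix h t ss = mat c ** rep_matrix h t (s @ r)" by (rule proj_class_eqD)
  have sr: "chamber h t (rep_matrix h t (s @ r) *v p)"
    using ss unfolding c by (simp add: matrix_vector_mul_assoc[symmetric] mat_vector_mult chamber_scale)
  have "r = []"
  proof (rule ccontr)
    assume "r \<noteq> []"
    then have "c_reduced r \<or> b_reduced r" using r by (simp add: reduced_tail_def)
    from foldr_reduced_not_base[OF base[OF p] s this] base[OF sr]
    show False by (simp add: rep_matrix_vector)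
  qed
  \<comment> \<open>With empty tail, \<open>\<iota>1\<close> exchanges the moduli of
    \<open>b\<close> and \<open>a + b\<close>, and \<open>\<iota>4\<close> those of \<open>a\<close>
    and \<open>a + b\<close>. Their strict order at both \<open>p\<close> and its image forces
    \<open>s\<close> to be empty.\<close>
  define a b where "a = p$2" and "b = coord4 h t p"
  have ab: "cmod a < cmod b" "cmod b < cmod (a + b)" using p by (auto simp: a_def b_def chamber_def)
  have ord: "cmod ((rep_matrix h t s *v p)$2) < cmod (coord4 h t (rep_matrix h t s *v p))"
    "cmod (coord4 h t (rep_matrix h t s *v p)) <
      cmod ((rep_matrix h t s *v p)$2 + coord4 h t (rep_matrix h t s *v p))"
    using sr \<open>r = []\<close> by (auto simp: chamber_def)
  have nab: "cmod (- b - a) = cmod (a + b)" "cmod (- a - b) = cmod (a + b)"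
    using norm_minus_commute[of "- b" a] norm_minus_commute[of "- a" b] by (simp_all add: add.commute)
  have "s = []"
    using s ord ab h nab unfolding S3_words_def
    by (auto simp: matrix_vector_mul_assoc[symmetric] refl1 refl4 coord4_refl4[OF par]
        a_def[symmetric] b_def[symmetric])
  then show "cox_eq ss []" using eq \<open>r = []\<close> by simp
qed

theorem theorem1p2:
  shows "\<exists>U. openin (top_of_set parameter_space) U \<and> (sqrt 2, arccos (- 7 / 8)) \<in> U \<and>
    (\<forall>(h, t)\<in>U. discrete_faithful_rep (\<rho> h t))"
proof -
  obtain W where W: "open W" "center \<in> W"
    "\<And>x. x \<in> W \<Longrightarrow> certified (fst x) (snd x) \<and> chamber (fst x) (snd x) base_point"
    using eventually_certified unfolding eventually_nhds by blast
  have "center \<in> parameter_space"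
    using arccos_lbound[of "- 7 / 8"] arccos_ubound[of "- 7 / 8"] by (simp add: parameter_space_def)
  moreover have "discrete_faithful_rep (\<rho> h t)" if "(h, t) \<in> parameter_space \<inter> W" for h t
    using W(3)[of "(h, t)"] that by (auto intro: discrete_faithful_if_certified)
  ultimately show ?thesis
    using W(1,2) by (intro exI[of _ "parameter_space \<inter> W"]) (auto intro: openin_open_Int)
qed

end
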